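(* For every $d\geq 5$, there exists an open set $\Omega\subset\mathbb{R}^d$ of finite measure such that: (i) $\Omega$ is connected; (ii) $\Omega$ is spectral; (iii) $\Omega$ does not tile $\mathbb{R}^d$ by translations.
   Context: A measurable set $\Omega\subset\mathbb{R}^d$ of positive, finite Lebesgue measure is called spectral if there is a set $\Lambda\subset\mathbb{R}^d$ such that the system $\{e^{2\pi i\lambda\cdot x}\}_{\lambda\in\Lambda}$ is an orthogonal basis for $L^2(\Omega)$. A measurable set $\Omega\subset\mathbb{R}^d$ of finite, positive measure tiles $\mathbb{R}^d$ by translations if there is a countable set $A\subset\mathbb{R}^d$ such that the translates $\Omega+a$, $a\in A$, cover almost every point of $\mathbb{R}^d$ exactly once. *)

theory Defs
  imports "HOL-Analysis.Analysis"
begin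

text \<open>\<open>L\<^sup>2\<close> is handled through representatives: elements are square-integrable complex functions,
  and two functions are identified when \<open>L2_norm\<close> of their difference is \<open>0\<close>,
  that is, when they agree almost everywhere.\<close>

definition L2_fun :: "'a measure \<Rightarrow> ('a \<Rightarrow> complex) set" where
  "L2_fun M = {f. f \<in> borel_measurable M \<and> integrable M (\<lambda>x. (norm (f x))\<^sup>2)}"

definition L2_inner :: "'a measure \<Rightarrow> ('a \<Rightarrow> complex) \<Rightarrow> ('a \<Rightarrow> complex) \<Rightarrow> complex" where
  "L2_inner M f g = (\<integral>x. f x * cnj (g x) \<partial>M)"

definition L2_norm :: "'a measure \<Rightarrow> ('a \<Rightarrow> complex) \<Rightarrow> real" where
  "L2_norm M f = sqrt (\<integral>x. (norm (f x))\<^sup>2 \<partial>M)"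

text \<open>A family of nonzero, pairwise orthogonal vectors whose linear span is dense.\<close>

definition orthogonal_basis_L2 :: "'a measure \<Rightarrow> 'i set \<Rightarrow> ('i \<Rightarrow> 'a \<Rightarrow> complex) \<Rightarrow> bool" where
  "orthogonal_basis_L2 M I e \<longleftrightarrow>
     (\<forall>i\<in>I. e i \<in> L2_fun M \<and> L2_norm M (e i) \<noteq> 0) \<and>
     (\<forall>i\<in>I. \<forall>j\<in>I. i \<noteq> j \<longrightarrow> L2_inner M (e i) (e j) = 0) \<and>
     (\<forall>f\<in>L2_fun M. \<forall>\<epsilon>>0. \<exists>J c. finite J \<and> J \<subseteq> I \<and>
        L2_norm M (\<lambda>x. f x - (\<Sum>j\<in>J. c j * e j x)) < \<epsilon>)"

definition fourier_exp :: "real ^ 'n \<Rightarrow> real ^ 'n \<Rightarrow> complex" where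
  "fourier_exp l x = exp (2 * of_real pi * \<i> * of_real (l \<bullet> x))"

definition spectral :: "(real ^ 'n) set \<Rightarrow> bool" where
  "spectral \<Omega> \<longleftrightarrow> \<Omega> \<in> lmeasurable \<and> measure lebesgue \<Omega> > 0 \<and>
     (\<exists>\<Lambda>. orthogonal_basis_L2 (lebesgue_on \<Omega>) \<Lambda> fourier_exp)"

definition tiles_by_translations :: "(real ^ 'n) set \<Rightarrow> bool" where
  "tiles_by_translations \<Omega> \<longleftrightarrow> \<Omega> \<in> lmeasurable \<and> measure lebesgue \<Omega> > 0 \<and>
     (\<exists>A. countable A \<and> (AE x in lebesgue. \<exists>!a. a \<in> A \<and> x \<in> (\<lambda>y. y + a) ` \<Omega>))"

end

theory Submission
  imports Defs
begin

text \<open>In \<open>\<int>\<^sub>3\<^sup>4\<close> the six points \<open>0, e\<^sub>1, \<dots>, e\<^sub>4, -(e\<^sub>1 + \<dots> + e\<^sub>4)\<close> are spectral, because a complex Hadamard matrix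
  of order 6 of cube roots of unity has exponents of rank 4 modulo 3, and they do not tile, because 6 does
  not divide 81. Adding the box \<open>3 \<cdot> {0, \<dots>, M - 1}\<^sup>4\<close> gives a finite set \<open>P \<subseteq> \<int>\<^sup>d\<close>, still spectral, that does not
  tile \<open>\<int>\<^sup>d\<close> if \<open>M\<close> is large.

  For every open fundamental domain \<open>D\<close> of \<open>\<int>\<^sup>d\<close> (up to null sets), connected or not, \<open>P + D\<close> is a disjoint union
  of translates of \<open>D\<close> that is spectral with spectrum \<open>S + \<int>\<^sup>d\<close>, and a tiling of \<open>\<real>\<^sup>d\<close> by \<open>P + D\<close> with translations \<open>A\<close>
  would make \<open>P\<close> tile almost every coset \<open>x + \<int>\<^sup>d\<close> with complement \<open>D + A\<close>. So \<open>D\<close> may be chosen freely to make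
  \<open>P + D\<close> connected. It is the unit cube cut into six layers orthogonal to a fifth coordinate axis, the layers
  being shifted sideways so that the layers of the different translates of \<open>D\<close> touch one another.\<close>

text \<open>The count against 81 only excludes 3-periodic tilings, and translations in the integer
  lattice need not be 3-periodic. The box supplies the missing periodicity locally: deep inside a
  large box the six-point pattern repeats with period 3 whatever the rest of the tiling does. With
  an unsheared cube as \<open>D\<close> the set would be disconnected, since the cubes at
  \<open>0\<close> and at \<open>-(e\<^sub>1 + \<dots> + e\<^sub>4)\<close> meet in a face of too
  low a dimension. Cubes in adjacent layers share a piece of a facet as soon as their sideways
  displacement is less than 1 in each direction, and a shift by one half lets a coordinate
  difference of 0 and one of a prescribed sign both qualify. One transition with equal signs joins
  the six simplex points, and one for each of the four directions joins neighbouring boxes of the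
  grid. These five transitions need six layers, and the stacking axis is the fifth
  dimension.\<close>

section \<open>A Hadamard matrix of cube roots of unity\<close>

text \<open>The points \<open>0, e\<^sub>1, \<dots>, e\<^sub>4, -(e\<^sub>1 + \<dots> + e\<^sub>4)\<close> of \<open>\<int>\<^sup>4\<close>, with coordinates numbered from 1.\<close>

definition simplex_pt :: "nat \<Rightarrow> nat \<Rightarrow> int" where
  "simplex_pt r m = (if r = 5 then -1 else if r = m then 1 else 0)"

text \<open>The matrix of the numbers \<open>root3 (phase s r)\<close> is a complex Hadamard matrix of order 6. Modulo 3 each row of exponents
  sums to 0, which is why they factor through \<open>\<int>\<^sup>4\<close>.\<close>

definition freq_pt :: "nat \<Rightarrow> nat \<Rightarrow> int" where
  "freq_pt r m = [[0,0,0,0], [0,1,1,2], [1,0,2,2], [1,2,0,1], [2,2,1,0], [2,1,2,1]] ! r ! (m - 1)"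

definition phase :: "nat \<Rightarrow> nat \<Rightarrow> int" where
  "phase s r = (\<Sum>m=1..4. freq_pt s m * simplex_pt r m)"

definition root3 :: "int \<Rightarrow> complex" where
  "root3 k = cis (2 * pi * (of_int k / 3))"

lemma root3_mod: "root3 k = root3 (k mod 3)"
proof -
  have "root3 k = root3 (k mod 3) * cis (2 * pi * of_int (k div 3))"
  proof -
    have "real_of_int k = of_int (k mod 3 + 3 * (k div 3))" by simp
    then have "of_int k / 3 = of_int (k mod 3) / 3 + (of_int (k div 3) :: real)"
      unfolding of_int_add of_int_mult by simp
    then have "2 * pi * (of_int k / 3) = 2 * pi * (of_int (k mod 3) / 3) + 2 * pi * of_int (k div 3)"
      by (simp only: ring_distribs)
    then show ?thesis unfolding root3_def by (simp only: cis_mult)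
  qed
  also have "cis (2 * pi * of_int (k div 3)) = 1" by (rule cis_multiple_2pi) simp
  finally show ?thesis by simp
qed

lemma root3_sum: "root3 0 + root3 1 + root3 2 = 0"
proof -
  have "cis (2 * pi / 3) \<noteq> 1"
  proof
    assume "cis (2 * pi / 3) = 1"
    then have "cos (2 * pi / 3) = 1" by (simp add: complex_eq_iff)
    then obtain n :: int where "2 * pi / 3 = of_int n * 2 * pi" by (auto simp: cos_one_2pi_int)
    then have "of_int (3 * n) = (1 :: real)" by (simp add: field_simps)
    then have "3 * n = 1" by linarith
    then show False by presburger
  qed
  moreover have "cis (2 * pi / 3) ^ 3 = 1" using Complex.DeMoivre[of "2 * pi / 3" 3] by simp
  moreover have "(w - 1) * (1 + w + w\<^sup>2) = w ^ 3 - 1" for w :: complex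
    by (simp add: algebra_simps power2_eq_square power3_eq_cube)
  ultimately have "1 + cis (2 * pi / 3) + (cis (2 * pi / 3))\<^sup>2 = 0" by (metis eq_iff_diff_eq_0 mult_eq_0_iff)
  then show ?thesis by (simp add: root3_def Complex.DeMoivre mult_ac)
qed

lemma less_6_cases: "r < 6 \<longleftrightarrow> r \<in> {0, 1, 2, 3, 4, 5 :: nat}"
  by auto

text \<open>This table is the Hadamard matrix written by exponents, with zero first row and column.
  Only the residues matter for \<open>root3\<close>, so both orthogonality relations reduce to a
  finite check on it.\<close>

lemma phase_mod_3:
  assumes "s < 6" "r < 6"
  shows "phase s r mod 3 = [[0,0,0,0,0,0], [0,0,1,1,2,2], [0,1,0,2,2,1], [0,1,2,0,1,2], [0,2,2,1,0,1], [0,2,1,2,1,0]] ! s ! r"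
  using assms unfolding less_6_cases
  by (auto simp: phase_def freq_pt_def simplex_pt_def numeral_eq_Suc atLeastAtMostSuc_conv)

lemma sum_less_6: "(\<Sum>r<6. f r) = f 0 + f 1 + f 2 + f 3 + f 4 + f (5 :: nat)"
  by (simp add: numeral_eq_Suc)

text \<open>Each of the three cube roots of unity occurs exactly twice, so the sum is twice
  \<open>root3 0 + root3 1 + root3 2\<close>.\<close>

lemma balanced:
  fixes c :: "nat \<Rightarrow> int"
  assumes "mset (map (\<lambda>r. c r mod 3) [0,1,2,3,4,5]) = mset [0,0,1,1,2,2]"
  shows "(\<Sum>r<6. root3 (c r)) = 0"
proof -
  have "(\<Sum>r<6. root3 (c r)) = (\<Sum>r<6. root3 (c r mod 3))"
    by (intro sum.cong refl root3_mod)
  also have "\<dots> = sum_mset (image_mset root3 (mset (map (\<lambda>r. c r mod 3) [0,1,2,3,4,5])))"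
    by (simp add: sum_less_6 add_ac)
  also have "\<dots> = 2 * (root3 0 + root3 1 + root3 2)"
    unfolding assms by (simp add: add_ac)
  finally show ?thesis by (simp add: root3_sum)
qed

lemma phase_row_orthogonal:
  assumes "s < 6" "t < 6" "s \<noteq> t"
  shows "(\<Sum>r<6. root3 (phase s r - phase t r)) = 0"
proof (rule balanced)
  have "(phase s r - phase t r) mod 3 = (phase s r mod 3 - phase t r mod 3) mod 3" for r
    by (simp add: mod_diff_eq)
  then show "mset (map (\<lambda>r. (phase s r - phase t r) mod 3) [0,1,2,3,4,5]) = mset [0,0,1,1,2,2]"
    using assms unfolding less_6_cases
    by (auto simp: phase_mod_3 add_mset_commute)
qed

lemma phase_column_orthogonal:
  assumes "r < 6" "q < 6" "r \<noteq> q"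
  shows "(\<Sum>s<6. root3 (phase s r - phase s q)) = 0"
proof (rule balanced)
  have "(phase s r - phase s q) mod 3 = (phase s r mod 3 - phase s q mod 3) mod 3" for s
    by (simp add: mod_diff_eq)
  then show "mset (map (\<lambda>s. (phase s r - phase s q) mod 3) [0,1,2,3,4,5]) = mset [0,0,1,1,2,2]"
    using assms unfolding less_6_cases
    by (auto simp: phase_mod_3 add_mset_commute)
qed

section \<open>A finite set that does not tile the integer lattice\<close>

abbreviation grid :: "nat \<Rightarrow> (nat \<Rightarrow> nat) set" where
  "grid M \<equiv> PiE {1..4} (\<lambda>_. {..<M})"

text \<open>Let \<open>B\<close> be the union of the boxes \<open>w + 3 \<cdot> grid M\<close>. At most \<open>9\<^sup>4\<close> of them come near the origin, so for
  large \<open>M\<close> there is a window \<open>Q\<close> of side 3 that stays away from all their faces. There \<open>B\<close> is 3-periodic,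
  hence its six translates meet \<open>Q\<close> in equally many points, but 6 does not divide \<open>3\<^sup>4\<close>.\<close>

lemma no_integer_tiling:
  fixes W :: "(nat \<Rightarrow> int) set" and M :: nat
  assumes M: "M > 4 * 9 ^ 4 + 2"
    and ex: "\<And>z :: nat \<Rightarrow> int. \<exists>w\<in>W. \<exists>r<6. \<exists>k\<in>grid M. \<forall>m\<in>{1..4}. z m = w m + simplex_pt r m + 3 * int (k m)"
    and uniq: "\<And>w r k w' r' k'. w \<in> W \<Longrightarrow> w' \<in> W \<Longrightarrow> r < 6 \<Longrightarrow> r' < 6 \<Longrightarrow> k \<in> grid M \<Longrightarrow> k' \<in> grid M \<Longrightarrow>
      (\<forall>m\<in>{1..4}. w m + simplex_pt r m + 3 * int (k m) = w' m + simplex_pt r' m + 3 * int (k' m)) \<Longrightarrow>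
      w = w' \<and> r = r' \<and> k = k'"
  shows False
proof -
  let ?I = "{1..4::nat}"
  \<comment> \<open>Only these translations matter: the window chosen below has coordinates between
    3 and \<open>3 * M - 4\<close>, and a box reaching it must start at distance less than
    \<open>3 * M\<close> from 0 in each direction.\<close>
  define W' where "W' = {w\<in>W. \<forall>m\<in>?I. \<bar>w m\<bar> < 3 * int M}"
  \<comment> \<open>The points with \<open>r = 0\<close>, where the simplex point is the origin,
    already give disjoint copies of the grid inside a cube of side \<open>9 * M\<close>. Comparing
    sizes bounds \<open>card W'\<close> by \<open>9 ^ 4\<close>, independently of
    \<open>M\<close>.\<close>
  define f where "f = (\<lambda>(w, k). restrict (\<lambda>m. w m + 3 * int (k m)) ?I)"
  have finT: "finite (?I \<rightarrow>\<^sub>E {-3 * int M..<6 * int M})" by (simp add: finite_PiE)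
  have sub: "f ` (W' \<times> grid M) \<subseteq> ?I \<rightarrow>\<^sub>E {-3 * int M..<6 * int M}"
  proof (rule image_subsetI)
    fix x assume "x \<in> W' \<times> grid M"
    then obtain w k where x: "x = (w, k)" "w \<in> W'" "k \<in> grid M" by blast
    have "w m + 3 * int (k m) \<in> {-3 * int M..<6 * int M}" if m: "m \<in> ?I" for m
    proof -
      have "\<bar>w m\<bar> < 3 * int M" "k m < M" using x m by (auto simp: W'_def)
      then show ?thesis by auto
    qed
    then show "f x \<in> ?I \<rightarrow>\<^sub>E {-3 * int M..<6 * int M}" unfolding x f_def by auto
  qed
  have inj: "inj_on f (W' \<times> grid M)"
  proof (rule inj_onI)
    fix x y assume xy: "x \<in> W' \<times> grid M" "y \<in> W' \<times> grid M" "f x = f y"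
    obtain w k w' k' where x: "x = (w, k)" "y = (w', k')" by fastforce
    have "w m + 3 * int (k m) = w' m + 3 * int (k' m)" if "m \<in> ?I" for m
      using fun_cong[OF xy(3), of m] that by (simp add: f_def x)
    then show "x = y" using uniq[of w w' 0 0 k k'] xy by (simp add: x W'_def)
  qed
  have cardG: "card (grid M) = M ^ 4" by (simp add: card_PiE)
  have "grid M \<noteq> {}" using M by (auto simp: PiE_eq_empty_iff lessThan_empty_iff)
  have "finite (W' \<times> grid M)" using inj sub finT by (metis finite_imageD finite_subset)
  then have finW: "finite W'" using \<open>grid M \<noteq> {}\<close> by (rule finite_cartesian_productD1)
  have "card W' * M ^ 4 \<le> (9 * M) ^ 4"
  proof -
    have "card W' * M ^ 4 = card (f ` (W' \<times> grid M))"
      by (simp only: card_image[OF inj] card_cartesian_product cardG)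
    also have "\<dots> \<le> card (?I \<rightarrow>\<^sub>E {-3 * int M..<6 * int M})" using sub finT by (rule card_mono[rotated])
    also have "\<dots> = (9 * M) ^ 4"
    proof -
      have "card {-3 * int M..<6 * int M} = 9 * M" by simp
      then show ?thesis by (simp only: card_PiE finite_atLeastAtMost prod_constant) simp
    qed
    finally show ?thesis .
  qed
  then have cardW: "card W' \<le> 9 ^ 4" using M by (simp add: power_mult_distrib)
  \<comment> \<open>A window position is rejected when a box begins or ends in it. The interval is
    closed at \<open>3 * int p + 3\<close>, one point beyond the window, to absorb the entries -1,
    0, 1 of the simplex points.\<close>
  define bad where "bad m w = {p :: nat. 3 * int p \<le> w m \<and> w m \<le> 3 * int p + 3 \<or>
    3 * int p \<le> w m + 3 * int M \<and> w m + 3 * int M \<le> 3 * int p + 3}" for m and w :: "nat \<Rightarrow> int"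
  have card_bad: "finite (bad m w) \<and> card (bad m w) \<le> 4" for m w
  proof -
    have "bad m w \<subseteq> nat ` {w m div 3 - 1, w m div 3, (w m + 3 * int M) div 3 - 1, (w m + 3 * int M) div 3}"
    proof
      fix p assume "p \<in> bad m w"
      then have "int p \<in> {w m div 3 - 1, w m div 3, (w m + 3 * int M) div 3 - 1, (w m + 3 * int M) div 3}"
        unfolding bad_def by auto
      then show "p \<in> nat ` {w m div 3 - 1, w m div 3, (w m + 3 * int M) div 3 - 1, (w m + 3 * int M) div 3}"
        by force
    qed
    moreover have "card (nat ` {w m div 3 - 1, w m div 3, (w m + 3 * int M) div 3 - 1, (w m + 3 * int M) div 3}) \<le> 4"
      by (rule order_trans[OF card_image_le]) (auto intro: order_trans[OF card_insert_le_m1] simp: card_insert_if)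
    ultimately show ?thesis by (meson card_mono finite.emptyI finite.insertI finite_imageI finite_subset order_trans)
  qed
  \<comment> \<open>There are \<open>M - 2\<close> candidates and each of the at most
    \<open>9 ^ 4\<close> boxes rejects at most 4 of them, which is where the lower bound on
    \<open>M\<close> comes from.\<close>
  have "\<exists>p. 1 \<le> p \<and> p < M - 1 \<and> (\<forall>w\<in>W'. p \<notin> bad m w)" for m
  proof (rule ccontr)
    assume "\<not> ?thesis"
    then have "{1..<M - 1} \<subseteq> (\<Union>w\<in>W'. bad m w)" by force
    then have "card {1..<M - 1} \<le> card (\<Union>w\<in>W'. bad m w)"
      using finW card_bad by (intro card_mono) auto
    also have "\<dots> \<le> (\<Sum>w\<in>W'. card (bad m w))" using finW by (rule card_UN_le)
    also have "\<dots> \<le> card W' * 4" using sum_bounded_above[of W' "\<lambda>w. card (bad m w)" 4] card_bad by simp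
    also have "\<dots> \<le> 9 ^ 4 * 4" using cardW by simp
    finally show False using M by simp
  qed
  then obtain p where p: "\<And>m. 1 \<le> p m" "\<And>m. p m < M - 1" "\<And>m w. w \<in> W' \<Longrightarrow> p m \<notin> bad m w" by metis
  define Q where "Q = (\<Pi>\<^sub>E m\<in>?I. {3 * int (p m)..<3 * int (p m) + 3})"
  have finQ: "finite Q" unfolding Q_def by (intro finite_PiE) auto
  have cardQ: "card Q = 81" unfolding Q_def by (simp add: card_PiE)
  define N where "N r = {q\<in>Q. \<exists>w\<in>W. \<exists>k\<in>grid M. \<forall>m\<in>?I. q m = w m + simplex_pt r m + 3 * int (k m)}" for r
  have finN: "finite (N r)" for r using finQ by (simp add: N_def)
  have "Q = (\<Union>r<6. N r)"
  proof
    show "Q \<subseteq> (\<Union>r<6. N r)"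
    proof
      fix q assume "q \<in> Q"
      then show "q \<in> (\<Union>r<6. N r)" using ex[of q] unfolding N_def by blast
    qed
  qed (auto simp: N_def)
  moreover have "N r \<inter> N r' = {}" if "r < 6" "r' < 6" "r \<noteq> r'" for r r'
  proof (rule ccontr)
    assume "N r \<inter> N r' \<noteq> {}"
    then obtain q w k w' k' where "w \<in> W" "k \<in> grid M" "\<forall>m\<in>?I. q m = w m + simplex_pt r m + 3 * int (k m)"
      "w' \<in> W" "k' \<in> grid M" "\<forall>m\<in>?I. q m = w' m + simplex_pt r' m + 3 * int (k' m)"
      unfolding N_def by blast
    then show False using uniq[of w w' r r' k k'] that by simp
  qed
  ultimately have sumN: "81 = (\<Sum>r<6. card (N r))"
    using finN by (subst cardQ[symmetric], simp only:, subst card_UN_disjoint) auto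
  have le: "card (N r) \<le> card (N r')" if r: "r < 6" "r' < 6" for r r'
  proof (rule card_inj_on_le[OF _ _ finN])
    \<comment> \<open>Replacing \<open>r\<close> by \<open>r'\<close> shifts a point by the
      difference of two simplex points; reduction modulo 3 returns it to the window. The result is
      still covered with the same \<open>w\<close>, because no face of that box is near: subtracting
      \<open>w\<close> and the new simplex point leaves a multiple of 3 in the admissible
      range.\<close>
    define g where "g q = restrict (\<lambda>m. 3 * int (p m) + (q m - simplex_pt r m + simplex_pt r' m) mod 3) ?I"
      for q :: "nat \<Rightarrow> int"
    show "inj_on g (N r)"
    proof (rule inj_onI)
      fix q q' assume q: "q \<in> N r" "q' \<in> N r" "g q = g q'"
      have "q m = q' m" if "m \<in> ?I" for m
      proof -
        have "(q m - simplex_pt r m + simplex_pt r' m) mod 3 = (q' m - simplex_pt r m + simplex_pt r' m) mod 3"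
          using fun_cong[OF q(3), of m] that by (simp add: g_def)
        then have "3 dvd (q m - simplex_pt r m + simplex_pt r' m) - (q' m - simplex_pt r m + simplex_pt r' m)"
          by (simp only: mod_eq_dvd_iff)
        then obtain c where "q m - q' m = 3 * c" by (auto elim!: dvdE)
        moreover have "q m \<in> {3 * int (p m)..<3 * int (p m) + 3}" "q' m \<in> {3 * int (p m)..<3 * int (p m) + 3}"
          using q(1,2) that unfolding N_def Q_def by (auto dest: PiE_mem)
        ultimately have "-3 < 3 * c" "3 * c < 3" by auto
        then show ?thesis using \<open>q m - q' m = 3 * c\<close> by simp
      qed
      then show "q = q'" using q(1,2) unfolding N_def Q_def
        by (intro extensionalityI[of q ?I q']) (auto simp: PiE_def)
    qed
    show "g ` N r \<subseteq> N r'"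
    proof safe
      fix q assume "q \<in> N r"
      then obtain w k where q: "q \<in> Q" and w: "w \<in> W" "k \<in> grid M"
        and qw: "\<And>m. m \<in> ?I \<Longrightarrow> q m = w m + simplex_pt r m + 3 * int (k m)"
        unfolding N_def by blast
      have rng: "3 * int (p m) \<le> q m \<and> q m < 3 * int (p m) + 3" if "m \<in> ?I" for m
        using PiE_mem[OF q[unfolded Q_def] that] by simp
      have pt: "-1 \<le> simplex_pt r m \<and> simplex_pt r m \<le> 1" for r m by (simp add: simplex_pt_def)
      have kM: "int (k m) < int M" if "m \<in> ?I" for m using PiE_mem[OF w(2) that] by simp
      have pM: "1 \<le> int (p m) \<and> int (p m) \<le> int M - 2" for m using p(1,2)[of m] by linarith
      have "w \<in> W'" unfolding W'_def
      proof (safe intro!: w(1))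
        fix m assume m: "m \<in> ?I"
        show "\<bar>w m\<bar> < 3 * int M"
          using qw[OF m] rng[OF m] pt[of r m] kM[OF m] pM[of m] by linarith
      qed
      then have notbad: "p m \<notin> bad m w" for m using p(3) by blast
      define b where "b m = g q m - simplex_pt r' m - w m" for m
      have b: "3 dvd b m \<and> 0 \<le> b m \<and> b m < 3 * int M" if m: "m \<in> ?I" for m
      proof -
        have gq: "g q m = 3 * int (p m) + (q m - simplex_pt r m + simplex_pt r' m) mod 3"
          using m by (simp add: g_def)
        have "b m mod 3 = (q m - simplex_pt r m + simplex_pt r' m - simplex_pt r' m - w m) mod 3"
          unfolding b_def gq by (metis (no_types, opaque_lifting) mod_diff_left_eq mod_mult_self4 mod_mod_trivial)
        also have "\<dots> = 0" using qw[OF m] by simp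
        finally have "3 dvd b m" by presburger
        moreover have "0 \<le> (q m - simplex_pt r m + simplex_pt r' m) mod 3"
           "(q m - simplex_pt r m + simplex_pt r' m) mod 3 < 3" by simp_all
        moreover have "w m < 3 * int (p m)"
        proof (rule ccontr)
          assume "\<not> w m < 3 * int (p m)"
          then have "3 * int (p m) + 3 < w m" using notbad[of m] by (simp add: bad_def)
          then show False using qw[OF m] rng[OF m] pt[of r m] by linarith
        qed
        moreover have "3 * int (p m) + 3 < w m + 3 * int M"
        proof (rule ccontr)
          assume "\<not> 3 * int (p m) + 3 < w m + 3 * int M"
          then have "w m + 3 * int M < 3 * int (p m)" using notbad[of m] by (auto simp: bad_def)
          then have "w m + 3 * int M \<le> 3 * int (p m) - 1" by linarith
          then show False using qw[OF m] rng[OF m] pt[of r m] kM[OF m] by linarith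
        qed
        ultimately show ?thesis
          using gq pt[of r' m] unfolding b_def by linarith
      qed
      define k' where "k' = restrict (\<lambda>m. nat (b m div 3)) ?I"
      have "nat (b m div 3) < M" if "m \<in> ?I" for m
        using b[OF that] M by (auto elim!: dvdE)
      then have "k' \<in> grid M" unfolding k'_def by auto
      moreover have "g q m = w m + simplex_pt r' m + 3 * int (k' m)" if m: "m \<in> ?I" for m
      proof -
        have "3 * int (k' m) = b m" using b[OF m] m by (auto simp: k'_def)
        then show ?thesis by (simp add: b_def)
      qed
      moreover have "g q \<in> Q"
        unfolding Q_def g_def by auto
      ultimately show "g q \<in> N r'" using w(1) unfolding N_def by blast
    qed
  qed
  have "(\<Sum>r<6. card (N r)) = (\<Sum>r<(6::nat). card (N 0))"
  proof (rule sum.cong[OF refl])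
    fix r :: nat assume "r \<in> {..<6}"
    then show "card (N r) = card (N 0)"
      using le[of r 0] le[of 0 r] by (intro antisym) auto
  qed
  then have "81 = 6 * card (N 0)" using sumN by simp
  then show False by presburger
qed

section \<open>Trigonometric polynomials\<close>

definition int_lattice :: "(real ^ 'n) set" where
  "int_lattice = {z. \<forall>i. z $ i \<in> \<int>}"

lemma int_lattice_closed [simp, intro]:
  "0 \<in> int_lattice"
  "x \<in> int_lattice \<Longrightarrow> - x \<in> int_lattice"
  "x \<in> int_lattice \<Longrightarrow> y \<in> int_lattice \<Longrightarrow> x + y \<in> int_lattice"
  "x \<in> int_lattice \<Longrightarrow> y \<in> int_lattice \<Longrightarrow> x - y \<in> int_lattice"
  by (auto simp: int_lattice_def)

lemma axis_int_lattice: "axis i (of_int k) \<in> int_lattice"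
  by (auto simp: int_lattice_def axis_def)

lemma inner_int_lattice:
  "x \<in> int_lattice \<Longrightarrow> y \<in> int_lattice \<Longrightarrow> x \<bullet> y \<in> \<int>"
  by (auto simp: int_lattice_def inner_vec_def intro!: Ints_sum)

lemma countable_int_lattice: "countable (int_lattice :: (real ^ 'n::finite) set)"
proof -
  have "int_lattice \<subseteq> range (\<lambda>f :: ('n \<Rightarrow> int). (\<chi> i. of_int (f i)) :: real ^ 'n)"
  proof
    fix z :: "real ^ 'n" assume "z \<in> int_lattice"
    then have "z = (\<chi> i. of_int \<lfloor>z $ i\<rfloor>)"
      by (auto simp: vec_eq_iff int_lattice_def elim: Ints_cases)
    then show "z \<in> range (\<lambda>f :: ('n \<Rightarrow> int). (\<chi> i. of_int (f i)) :: real ^ 'n)"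
      by (metis rangeI)
  qed
  moreover have "countable (UNIV :: ('n \<Rightarrow> int) set)"
  proof -
    have "countable (PiE (UNIV :: 'n set) (\<lambda>_. UNIV :: int set))"
      by (rule countable_PiE) auto
    then show ?thesis by (simp add: PiE_UNIV_domain)
  qed
  ultimately show ?thesis
    by (meson countable_image countable_subset)
qed

lemma fourier_exp_eq_cis: "fourier_exp l x = cis (2 * pi * (l \<bullet> x))"
  by (simp add: fourier_exp_def cis_conv_exp mult_ac)

lemma fourier_exp_add_left: "fourier_exp (a + b) x = fourier_exp a x * fourier_exp b x"
  by (simp add: fourier_exp_eq_cis cis_mult inner_add_left ring_distribs)

lemma fourier_exp_add_right: "fourier_exp a (x + y) = fourier_exp a x * fourier_exp a y"
  by (simp add: fourier_exp_eq_cis cis_mult inner_add_right ring_distribs)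

lemma fourier_exp_0 [simp]: "fourier_exp 0 x = 1" "fourier_exp l 0 = 1"
  by (simp_all add: fourier_exp_eq_cis)

lemma norm_fourier_exp [simp]: "norm (fourier_exp l x) = 1"
  by (simp add: fourier_exp_eq_cis)

lemma cnj_fourier_exp: "cnj (fourier_exp l x) = fourier_exp (- l) x"
  by (simp add: fourier_exp_eq_cis cis_cnj)

lemma fourier_exp_minus_right: "fourier_exp l (- x) = fourier_exp (- l) x"
  by (simp add: fourier_exp_eq_cis)

lemma fourier_exp_eq_1: "l \<bullet> x \<in> \<int> \<Longrightarrow> fourier_exp l x = 1"
  by (auto simp: fourier_exp_eq_cis elim!: Ints_cases intro: cis_multiple_2pi)

lemma continuous_on_fourier_exp [continuous_intros]:
  "continuous_on S f \<Longrightarrow> continuous_on S (\<lambda>x. fourier_exp l (f x))"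
  unfolding fourier_exp_def by (intro continuous_intros)

text \<open>Inductive rather than explicit finite sums, so that products, shifts and continuity
  follow by rule induction; \<open>fourier_span_representation\<close> recovers the sums.\<close>

inductive fourier_span :: "(real ^ 'n) set \<Rightarrow> (real ^ 'n \<Rightarrow> complex) \<Rightarrow> bool" for L where
  monom: "l \<in> L \<Longrightarrow> fourier_span L (\<lambda>x. c * fourier_exp l x)"
| add: "fourier_span L p \<Longrightarrow> fourier_span L q \<Longrightarrow> fourier_span L (\<lambda>x. p x + q x)"

abbreviation "trig_poly \<equiv> fourier_span int_lattice"

lemma trig_poly_const: "trig_poly (\<lambda>x. c)"
  using fourier_span.monom[of 0 int_lattice c] by simp

lemma trig_poly_mult:
  assumes "trig_poly p" "trig_poly q"
  shows "trig_poly (\<lambda>x. p x * q x)"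
  using assms
proof (induction p rule: fourier_span.induct)
  case (monom z c)
  from monom(2) show ?case
  proof (induction q rule: fourier_span.induct)
    case (monom z' c')
    have "(\<lambda>x. (c * c') * fourier_exp (z + z') x) = (\<lambda>x. c * fourier_exp z x * (c' * fourier_exp z' x))"
      by (auto simp: fourier_exp_add_left)
    with fourier_span.monom[of "z + z'" int_lattice "c * c'"] monom \<open>z \<in> int_lattice\<close> show ?case by auto
  next
    case (add p q)
    then show ?case using fourier_span.add by (force simp: ring_distribs)
  qed
next
  case (add p p')
  then show ?case using fourier_span.add by (force simp: ring_distribs)
qed

lemma fourier_span_sum:
  assumes "L \<noteq> {}" "\<And>i. i \<in> I \<Longrightarrow> fourier_span L (f i)"
  shows "fourier_span L (\<lambda>x. \<Sum>i\<in>I. f i x)"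
  using assms(2)
proof (induction I rule: infinite_finite_induct)
  case (infinite I)
  obtain l where "l \<in> L" using assms(1) by blast
  then show ?case using fourier_span.monom[of l L 0] infinite(1) by simp
next
  case empty
  obtain l where "l \<in> L" using assms(1) by blast
  then show ?case using fourier_span.monom[of l L 0] by simp
qed (auto intro: fourier_span.add)

lemma fourier_span_representation:
  assumes "fourier_span L p"
  obtains J c where "finite J" "J \<subseteq> L" "p = (\<lambda>x. \<Sum>l\<in>J. c l * fourier_exp l x)"
proof -
  from assms have "\<exists>J c. finite J \<and> J \<subseteq> L \<and> p = (\<lambda>x. \<Sum>l\<in>J. c l * fourier_exp l x)"
  proof (induction p rule: fourier_span.induct)
    case (monom l c)
    then show ?case by (intro exI[of _ "{l}"] exI[of _ "\<lambda>_. c"]) auto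
  next
    case (add p q)
    then obtain J c K d where J: "finite J" "J \<subseteq> L" "p = (\<lambda>x. \<Sum>l\<in>J. c l * fourier_exp l x)"
      and K: "finite K" "K \<subseteq> L" "q = (\<lambda>x. \<Sum>l\<in>K. d l * fourier_exp l x)" by blast
    define c' where "c' l = (if l \<in> J then c l else 0)" for l
    define d' where "d' l = (if l \<in> K then d l else 0)" for l
    have "p = (\<lambda>x. \<Sum>l\<in>J \<union> K. c' l * fourier_exp l x)"
      unfolding J c'_def using J K by (intro ext sum.mono_neutral_cong_left) auto
    moreover have "q = (\<lambda>x. \<Sum>l\<in>J \<union> K. d' l * fourier_exp l x)"
      unfolding K d'_def using J K by (intro ext sum.mono_neutral_cong_left) auto
    ultimately show ?case using J K
      by (intro exI[of _ "J \<union> K"] exI[of _ "\<lambda>l. c' l + d' l"])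
         (auto simp: ring_distribs sum.distrib)
  qed
  with that show ?thesis by blast
qed

lemma fourier_span_shift:
  assumes "fourier_span L p"
  shows "fourier_span ((+) s ` L) (\<lambda>x. p x * fourier_exp s x)"
  using assms
proof (induction p rule: fourier_span.induct)
  case (monom l c)
  have "(\<lambda>x. c * fourier_exp l x * fourier_exp s x) = (\<lambda>x. c * fourier_exp (s + l) x)"
    by (auto simp: fourier_exp_add_left)
  then show ?case using fourier_span.monom[of "s + l" "(+) s ` L" c] monom by auto
next
  case (add p q)
  then show ?case using fourier_span.add by (force simp: ring_distribs)
qed

lemma fourier_span_mono:
  "fourier_span L p \<Longrightarrow> L \<subseteq> L' \<Longrightarrow> fourier_span L' p"
  by (induction p rule: fourier_span.induct) (auto intro: fourier_span.intros)

section \<open>Uniform density of trigonometric polynomials on the torus\<close>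

definition torus_map :: "real ^ 'n \<Rightarrow> complex ^ 'n" where
  "torus_map x = (\<chi> i. cis (2 * pi * x $ i))"

lemma torus_map_nth: "torus_map x $ i = fourier_exp (axis i 1) x"
  by (simp add: torus_map_def fourier_exp_eq_cis inner_axis')

text \<open>On the torus the real and imaginary parts of a coordinate \<open>v\<close> are
  \<open>(v + cnj v) / 2\<close> and \<open>(v - cnj v) / (2 * \<i>)\<close>, and \<open>v\<close>
  and \<open>cnj v\<close> are exponentials with frequencies \<open>axis i 1\<close> and
  \<open>axis i (-1)\<close>. Products stay in the class by \<open>trig_poly_mult\<close>.\<close>

lemma trig_poly_real_polynomial:
  fixes g :: "complex ^ 'n::finite \<Rightarrow> real"
  assumes "real_polynomial_function g"
  shows "trig_poly (\<lambda>x. of_real (g (torus_map x)))"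
  using assms
proof (induction g rule: real_polynomial_function.induct)
  case (linear f)
  let ?p = "\<lambda>i x. (of_real (f (axis i 1)) / 2 + of_real (f (axis i \<i>)) / (2 * \<i>)) * fourier_exp (axis i 1) x"
  let ?q = "\<lambda>i x. (of_real (f (axis i 1)) / 2 - of_real (f (axis i \<i>)) / (2 * \<i>)) * fourier_exp (axis i (-1)) x"
  have eq: "of_real (f (torus_map x)) = (\<Sum>i\<in>UNIV. ?p i x + ?q i x)" for x :: "real ^ 'n"
  proof -
    define v where "v = torus_map x"
    have "v = (\<Sum>i\<in>UNIV. Re (v $ i) *\<^sub>R axis i 1 + Im (v $ i) *\<^sub>R axis i \<i>)"
      by (auto simp: vec_eq_iff complex_eq_iff axis_def if_distrib if_distribR sum.distrib cong: if_cong)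
    then have "f v = f (\<Sum>i\<in>UNIV. Re (v $ i) *\<^sub>R axis i 1 + Im (v $ i) *\<^sub>R axis i \<i>)" by simp
    also have "\<dots> = (\<Sum>i\<in>UNIV. Re (v $ i) * f (axis i 1) + Im (v $ i) * f (axis i \<i>))"
      using bounded_linear.linear[OF linear(1)]
      by (simp add: linear_sum linear_add linear_scale)
    finally have "complex_of_real (f v) = of_real \<dots>" by simp
    also have "\<dots> = (\<Sum>i\<in>UNIV. ?p i x + ?q i x)"
      unfolding of_real_sum
    proof (rule sum.cong[OF refl])
      fix i
      have m: "fourier_exp (axis i (-1)) x = cnj (v $ i)" "fourier_exp (axis i 1) x = v $ i"
        by (simp_all add: v_def torus_map_nth fourier_exp_eq_cis inner_axis' cis_cnj)
      show "of_real (Re (v $ i) * f (axis i 1) + Im (v $ i) * f (axis i \<i>)) = ?p i x + ?q i x"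
        unfolding m by (simp add: complex_eq_iff field_simps)
    qed
    finally show ?thesis by (simp add: v_def)
  qed
  have "axis i 1 \<in> int_lattice" "axis i (-1) \<in> int_lattice" for i :: 'n
    using axis_int_lattice[of i 1] axis_int_lattice[of i "-1"] by auto
  then show ?case unfolding eq
    by (intro fourier_span_sum fourier_span.add fourier_span.monom) auto
next
  case (const c)
  show ?case by (rule trig_poly_const)
next
  case (add f g)
  then show ?case using fourier_span.add by force
next
  case (mult f g)
  then show ?case using trig_poly_mult by force
qed

lemma torus_map_eq_iff: "torus_map x = torus_map y \<longleftrightarrow> x - y \<in> int_lattice"
proof -
  have "cis (2 * pi * a) = cis (2 * pi * b) \<longleftrightarrow> a - b \<in> \<int>" for a b :: real
  proof -
    have "cis (2 * pi * a) = cis (2 * pi * b) \<longleftrightarrow> cis (2 * pi * (a - b)) = 1"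
      by (simp add: cis_divide[symmetric] right_diff_distrib)
    also have "\<dots> \<longleftrightarrow> a - b \<in> \<int>"
    proof
      assume "cis (2 * pi * (a - b)) = 1"
      then have "cos (2 * pi * (a - b)) = 1" by (simp add: complex_eq_iff)
      then obtain n :: int where "2 * pi * (a - b) = of_int n * 2 * pi"
        by (auto simp: cos_one_2pi_int)
      then have "a - b = of_int n" by simp
      then show "a - b \<in> \<int>" by simp
    qed (auto elim!: Ints_cases intro: cis_multiple_2pi)
    finally show ?thesis .
  qed
  then show ?thesis
    by (simp add: torus_map_def vec_eq_iff int_lattice_def)
qed

text \<open>A periodic function factors through \<open>torus_map\<close>, so Stone-Weierstrass on
  the compact image of the unit cube applies, and polynomials on that image pull back to
  trigonometric polynomials.\<close>

lemma trig_poly_approximation: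
  fixes H :: "real ^ 'n::finite \<Rightarrow> complex"
  assumes cont: "continuous_on UNIV H"
    and per: "\<And>x z. z \<in> int_lattice \<Longrightarrow> H (x + z) = H x"
    and "0 < \<epsilon>"
  obtains p where "trig_poly p" "\<And>x. norm (H x - p x) < \<epsilon>"
proof -
  define Q :: "(real ^ 'n) set" where "Q = cbox 0 (\<chi> i. 1)"
  define K where "K = torus_map ` Q"
  have contt: "continuous_on S torus_map" for S :: "(real ^ 'n) set"
    unfolding torus_map_def cis_conv_exp by (intro continuous_intros)
  have Q: "compact Q" by (simp add: Q_def)
  have K: "compact K" unfolding K_def using contt Q by (rule compact_continuous_image)
  have red: "\<exists>y\<in>Q. x - y \<in> int_lattice" for x :: "real ^ 'n"
  proof (rule bexI[of _ "\<chi> i. frac (x $ i)"])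
    show "x - (\<chi> i. frac (x $ i)) \<in> int_lattice"
      by (simp add: int_lattice_def frac_def)
    show "(\<chi> i. frac (x $ i)) \<in> Q"
      by (auto simp: Q_def mem_box_cart intro: less_imp_le frac_lt_1)
  qed
  have factor: "H x = H y" if "torus_map x = torus_map y" for x y
    using per[of "x - y" y] that by (simp add: torus_map_eq_iff)
  define H' where "H' v = H (SOME y. y \<in> Q \<and> torus_map y = v)" for v
  have H': "H' (torus_map x) = H x" for x
  proof -
    obtain y where "y \<in> Q" "torus_map y = torus_map x"
      using red[of x] by (metis torus_map_eq_iff)
    then have "torus_map (SOME y. y \<in> Q \<and> torus_map y = torus_map x) = torus_map x"
      by (metis (mono_tags, lifting) someI_ex)
    then show ?thesis unfolding H'_def by (rule factor)
  qed
  \<comment> \<open>A continuous map of the compact cube onto its Hausdorff image is a quotient map,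
    so continuity of \<open>H\<close> descends to \<open>H'\<close> although \<open>H'\<close> is
    defined by an arbitrary choice of preimages.\<close>
  have "continuous_on K H'"
    unfolding continuous_openin_preimage_eq
  proof (intro allI impI)
    fix T :: "complex set" assume "open T"
    have "Q \<inter> torus_map -` (K \<inter> H' -` T) = Q \<inter> H -` T"
      by (auto simp: K_def H') (metis factor)
    moreover have "openin (top_of_set Q) (Q \<inter> H -` T)"
      using cont \<open>open T\<close> by (meson continuous_on_subset continuous_openin_preimage_gen subset_UNIV)
    ultimately show "openin (top_of_set K) (K \<inter> H' -` T)"
      using Abstract_Topology_2.continuous_imp_quotient_map[OF contt _ Q, of K "K \<inter> H' -` T"] by (simp add: K_def)
  qed
  obtain g where g: "polynomial_function g" "\<And>v. v \<in> K \<Longrightarrow> norm (H' v - g v) < \<epsilon>"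
    using Stone_Weierstrass_polynomial_function[OF K \<open>continuous_on K H'\<close> \<open>0 < \<epsilon>\<close>] by blast
  have "real_polynomial_function (Re \<circ> g)" "real_polynomial_function (Im \<circ> g)"
    using g(1) bounded_linear_Re bounded_linear_Im by (auto simp: polynomial_function_def)
  then have "trig_poly (\<lambda>x. of_real ((Re \<circ> g) (torus_map x)) + \<i> * of_real ((Im \<circ> g) (torus_map x)))"
    by (intro fourier_span.add trig_poly_mult trig_poly_const trig_poly_real_polynomial)
  moreover have "of_real ((Re \<circ> g) (torus_map x)) + \<i> * of_real ((Im \<circ> g) (torus_map x)) = g (torus_map x)"
    for x by (simp add: complex_eq_iff)
  ultimately have "trig_poly (\<lambda>x. g (torus_map x))" by simp
  moreover have "norm (H x - g (torus_map x)) < \<epsilon>" for x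
  proof -
    obtain y where y: "y \<in> Q" "torus_map y = torus_map x"
      using red[of x] by (metis torus_map_eq_iff)
    then have "torus_map x \<in> K" unfolding K_def by (metis imageI)
    from g(2)[OF this] show ?thesis by (simp add: H')
  qed
  ultimately show ?thesis using that by blast
qed

section \<open>Exponential bases of unions of lattice tiles\<close>

definition clip :: "real \<Rightarrow> complex \<Rightarrow> complex" where
  "clip k w = w / of_real (max 1 (norm w / k))"

lemma norm_clip_le: "0 < k \<Longrightarrow> norm (clip k w) \<le> k"
proof -
  assume k: "0 < k"
  have "norm w \<le> k * max 1 (norm w / k)"
    using k by (auto simp: max_def field_simps)
  moreover have "0 < max 1 (norm w / k)" by linarith
  ultimately show ?thesis
    by (simp add: clip_def norm_divide pos_divide_le_eq)
qed

lemma norm_diff_clip_le: "norm (w - clip k w) \<le> norm w"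
proof -
  define m where "m = max 1 (norm w / k)"
  have m: "1 \<le> m" by (simp add: m_def)
  have "w - clip k w = w * of_real (1 - 1 / m)"
    by (simp add: clip_def m_def[symmetric] algebra_simps)
  moreover have "\<bar>1 - 1 / m\<bar> \<le> 1" using m by (simp add: abs_le_iff field_simps)
  ultimately show ?thesis
    by (simp only: norm_mult norm_of_real) (simp add: mult_left_le)
qed

lemma continuous_on_clip [continuous_intros]:
  "continuous_on S f \<Longrightarrow> continuous_on S (\<lambda>x. clip k (f x))"
  unfolding clip_def divide_inverse[of _ k] by (intro continuous_intros) (auto simp: max_def)

lemma tendsto_clip: "(\<lambda>n. clip (real n) w) \<longlonglongrightarrow> w"
proof (rule tendsto_eventually)
  have "eventually (\<lambda>n. max 1 (norm w) \<le> real n) sequentially"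
    using filterlim_real_sequentially unfolding filterlim_at_top by blast
  then show "eventually (\<lambda>n. clip (real n) w = w) sequentially"
  proof eventually_elim
    fix n assume "max 1 (norm w) \<le> real n"
    then have "norm w / real n \<le> 1" by (simp add: divide_le_eq_1)
    then show "clip (real n) w = w" by (simp add: clip_def max_absorb1)
  qed
qed

lemma norm_add_squared_le: "(norm (a + b))\<^sup>2 \<le> 2 * (norm a)\<^sup>2 + 2 * (norm b)\<^sup>2"
  for a b :: "'a::real_normed_vector"
proof -
  have "(norm (a + b))\<^sup>2 \<le> (norm a + norm b)\<^sup>2"
    by (intro power_mono norm_triangle_ineq norm_ge_zero)
  also have "\<dots> \<le> 2 * (norm a)\<^sup>2 + 2 * (norm b)\<^sup>2"
    using sum_squares_bound[of "norm a" "norm b"] by (simp add: power2_sum)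
  finally show ?thesis .
qed

lemma norm_diff_squared_triangle: "(norm (a - c))\<^sup>2 \<le> 2 * (norm (a - b))\<^sup>2 + 2 * (norm (b - c))\<^sup>2"
  for a b c :: "'a::real_normed_vector"
  using norm_add_squared_le[of "a - b" "b - c"] by simp

text \<open>Radial clipping makes \<open>f\<close> bounded, \<open>measurable_on\<close> supplies
  continuous functions converging to it almost everywhere, and a cutoff makes these vanish outside
  \<open>U\<close>; dominated convergence controls both errors. Vanishing outside \<open>U\<close>
  is what later makes a periodization continuous.\<close>

lemma L2_approx_continuous:
  fixes U \<Omega> :: "'a::euclidean_space set" and f :: "'a \<Rightarrow> complex"
  assumes U: "open U" "U \<subseteq> \<Omega>" "U \<noteq> UNIV" and \<Omega>: "\<Omega> \<in> lmeasurable" and neg: "negligible (\<Omega> - U)"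
    and f: "f \<in> L2_fun (lebesgue_on \<Omega>)" and "0 < \<epsilon>"
  obtains G B where "continuous_on UNIV G" "\<And>x. x \<notin> U \<Longrightarrow> G x = 0" "\<And>x. norm (G x) \<le> B"
    "(\<integral>x. (norm (f x - G x))\<^sup>2 \<partial>lebesgue_on \<Omega>) < \<epsilon>"
proof -
  let ?M = "lebesgue_on \<Omega>"
  interpret finite_measure ?M
    using \<Omega> by (rule finite_measure_lebesgue_on)
  have [measurable]: "f \<in> borel_measurable ?M" and int_f: "integrable ?M (\<lambda>x. (norm (f x))\<^sup>2)"
    using f by (auto simp: L2_fun_def)
  have clip_meas [measurable]: "clip k \<in> borel_measurable borel" for k
    by (intro borel_measurable_continuous_onI continuous_intros)
  have "(\<lambda>n. \<integral>x. (norm (f x - clip (real n) (f x)))\<^sup>2 \<partial>?M) \<longlonglongrightarrow> (\<integral>x. 0 \<partial>?M)"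
  proof (rule integral_dominated_convergence[where w = "\<lambda>x. (norm (f x))\<^sup>2"])
    show "AE x in ?M. (\<lambda>n. (norm (f x - clip (real n) (f x)))\<^sup>2) \<longlonglongrightarrow> 0"
    proof (intro AE_I2)
      fix x
      have "(\<lambda>n. (norm (f x - clip (real n) (f x)))\<^sup>2) \<longlonglongrightarrow> (norm (f x - f x))\<^sup>2"
        by (intro tendsto_intros tendsto_clip)
      then show "(\<lambda>n. (norm (f x - clip (real n) (f x)))\<^sup>2) \<longlonglongrightarrow> 0" by simp
    qed
    show "AE x in ?M. norm ((norm (f x - clip (real n) (f x)))\<^sup>2) \<le> (norm (f x))\<^sup>2" for n
      by (intro AE_I2) (simp add: power_mono norm_diff_clip_le)
  qed (use int_f in measurable)
  then have "eventually (\<lambda>n. (\<integral>x. (norm (f x - clip (real n) (f x)))\<^sup>2 \<partial>?M) < \<epsilon> / 4) sequentially"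
    using \<open>0 < \<epsilon>\<close> by (intro order_tendstoD(2)[where a = "\<epsilon> / 4"]) auto
  with eventually_gt_at_top[of "0::nat"] have "eventually (\<lambda>n. 0 < n \<and>
      (\<integral>x. (norm (f x - clip (real n) (f x)))\<^sup>2 \<partial>?M) < \<epsilon> / 4) sequentially"
    by eventually_elim auto
  then obtain n where "0 < n" "(\<integral>x. (norm (f x - clip (real n) (f x)))\<^sup>2 \<partial>?M) < \<epsilon> / 4"
    using eventually_happens'[OF sequentially_bot] by blast
  define k where "k = real n"
  have k: "0 < k" "(\<integral>x. (norm (f x - clip k (f x)))\<^sup>2 \<partial>?M) < \<epsilon> / 4"
    using \<open>0 < n\<close> \<open>_ < \<epsilon> / 4\<close> by (simp_all add: k_def)
  have "(\<lambda>x. clip k (f x)) measurable_on \<Omega>"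
    using \<Omega> by (subst measurable_on_iff_borel_measurable) auto
  then obtain N g where N: "negligible N" and g: "\<And>n. continuous_on UNIV (g n)"
    "\<And>x. x \<notin> N \<Longrightarrow> (\<lambda>n. g n x) \<longlonglongrightarrow> (if x \<in> \<Omega> then clip k (f x) else 0)"
    unfolding measurable_on_def by blast
  \<comment> \<open>The cutoff is 0 outside \<open>U\<close> and tends to 1 on \<open>U\<close>,
    where the distance to the complement is positive; this needs \<open>U \<noteq> UNIV\<close>, as
    \<open>infdist\<close> to the empty set is 0. Clipping \<open>g n x\<close> once more gives a
    bound uniform in \<open>n\<close>.\<close>
  define G where "G n x = of_real (min 1 (real n * infdist x (- U))) * clip k (g n x)" for n x
  have contG: "continuous_on S (G n)" for n S
    unfolding G_def using g(1) 
    by (intro continuous_intros continuous_on_clip) (auto intro: continuous_on_subset)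
  have G0: "G n x = 0" if "x \<notin> U" for n x
    using that by (simp add: G_def)
  have GB: "norm (G n x) \<le> k" for n x
  proof -
    have "norm (G n x) = \<bar>min 1 (real n * infdist x (- U))\<bar> * norm (clip k (g n x))"
      by (simp add: G_def norm_mult)
    also have "\<dots> \<le> 1 * k"
      using k(1) by (intro mult_mono norm_clip_le) (auto simp: infdist_nonneg)
    finally show ?thesis by simp
  qed
  have bd: "norm (clip k (f x) - G n x) \<le> 2 * k" for n x
    using norm_triangle_ineq4[of "clip k (f x)" "G n x"] norm_clip_le[OF k(1), of "f x"] GB[of n x]
    by linarith
  have [measurable]: "G n \<in> borel_measurable ?M" for n
    using \<Omega> contG by (intro continuous_imp_measurable_on_sets_lebesgue) auto
  have "(\<lambda>n. \<integral>x. (norm (clip k (f x) - G n x))\<^sup>2 \<partial>?M) \<longlonglongrightarrow> (\<integral>x. 0 \<partial>?M)"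
  proof (rule integral_dominated_convergence[where w = "\<lambda>x. (2 * k)\<^sup>2"])
    have "negligible (N \<union> (\<Omega> - U))" using N neg by auto
    then have "AE x in lebesgue. x \<notin> N \<union> (\<Omega> - U)"
      using AE_not_in negligible_iff_null_sets by blast
    then have "AE x in ?M. x \<notin> N \<union> (\<Omega> - U)"
      using \<Omega> by (subst AE_restrict_space_iff) auto
    moreover have "AE x in ?M. x \<in> \<Omega>" by (intro AE_I2) simp
    ultimately show "AE x in ?M. (\<lambda>n. (norm (clip k (f x) - G n x))\<^sup>2) \<longlonglongrightarrow> 0"
    proof eventually_elim
      fix x assume x: "x \<notin> N \<union> (\<Omega> - U)" "x \<in> \<Omega>"
      then have "(\<lambda>n. g n x) \<longlonglongrightarrow> clip k (f x)" using g(2)[of x] by auto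
      moreover have "isCont (clip k) w" for w
        using continuous_on_clip[OF continuous_on_id, of UNIV k] by (simp add: continuous_on_eq_continuous_at)
      ultimately have 1: "(\<lambda>n. clip k (g n x)) \<longlonglongrightarrow> clip k (clip k (f x))"
        by (rule isCont_tendsto_compose[rotated])
      have "0 < infdist x (- U)"
        using U x by (intro infdist_pos_not_in_closed) auto
      then have "filterlim (\<lambda>n. real n * infdist x (- U)) at_top sequentially"
        by (intro filterlim_at_top_mult_tendsto_pos[OF tendsto_const] filterlim_real_sequentially)
      then have "eventually (\<lambda>n. 1 \<le> real n * infdist x (- U)) sequentially"
        by (auto simp: filterlim_at_top)
      then have "(\<lambda>n. min 1 (real n * infdist x (- U))) \<longlonglongrightarrow> 1"
        by (intro tendsto_eventually) (auto elim: eventually_mono)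
      then have "(\<lambda>n. G n x) \<longlonglongrightarrow> of_real 1 * clip k (clip k (f x))"
        unfolding G_def using 1 by (intro tendsto_intros)
      moreover have "clip k (clip k (f x)) = clip k (f x)"
        using norm_clip_le[OF k(1), of "f x"] k(1) by (simp add: clip_def[of k "clip k (f x)"] max_def field_simps)
      ultimately have "(\<lambda>n. (norm (clip k (f x) - G n x))\<^sup>2) \<longlonglongrightarrow> (norm (clip k (f x) - clip k (f x)))\<^sup>2"
        by (intro tendsto_intros) simp
      then show "(\<lambda>n. (norm (clip k (f x) - G n x))\<^sup>2) \<longlonglongrightarrow> 0" by simp
    qed
    show "AE x in ?M. norm ((norm (clip k (f x) - G n x))\<^sup>2) \<le> (2 * k)\<^sup>2" for n
      by (intro AE_I2) (simp only: real_norm_def abs_power2 power_mono[OF bd norm_ge_zero])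
  qed auto
  then have "eventually (\<lambda>n. (\<integral>x. (norm (clip k (f x) - G n x))\<^sup>2 \<partial>?M) < \<epsilon> / 4) sequentially"
    using \<open>0 < \<epsilon>\<close> by (intro order_tendstoD(2)[where a = "\<epsilon> / 4"]) auto
  then obtain n where n: "(\<integral>x. (norm (clip k (f x) - G n x))\<^sup>2 \<partial>?M) < \<epsilon> / 4"
    using eventually_happens'[OF sequentially_bot] by blast
  have i1: "integrable ?M (\<lambda>x. (norm (f x - clip k (f x)))\<^sup>2)"
    by (rule Bochner_Integration.integrable_bound[OF int_f])
       (auto intro!: AE_I2 power_mono norm_diff_clip_le)
  have i2: "integrable ?M (\<lambda>x. (norm (clip k (f x) - G n x))\<^sup>2)"
  proof (rule integrable_const_bound)
    show "AE x in ?M. norm ((norm (clip k (f x) - G n x))\<^sup>2) \<le> (2 * k)\<^sup>2"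
      by (intro AE_I2) (simp only: real_norm_def abs_power2 power_mono[OF bd norm_ge_zero])
  qed measurable
  have i3: "integrable ?M (\<lambda>x. 2 * (norm (f x - clip k (f x)))\<^sup>2 + 2 * (norm (clip k (f x) - G n x))\<^sup>2)"
    using i1 i2 by auto
  have "(\<integral>x. (norm (f x - G n x))\<^sup>2 \<partial>?M) \<le>
    (\<integral>x. 2 * (norm (f x - clip k (f x)))\<^sup>2 + 2 * (norm (clip k (f x) - G n x))\<^sup>2 \<partial>?M)"
    by (rule Bochner_Integration.integral_mono'[OF i3]) (auto intro: norm_diff_squared_triangle)
  also have "\<dots> = 2 * (\<integral>x. (norm (f x - clip k (f x)))\<^sup>2 \<partial>?M) + 2 * (\<integral>x. (norm (clip k (f x) - G n x))\<^sup>2 \<partial>?M)"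
    using i1 i2 by simp
  also have "\<dots> < \<epsilon>" using k(2) n by linarith
  finally show ?thesis using that[OF contG G0 GB] by blast
qed

text \<open>Discarding a null set replaces \<open>\<Omega>\<close> by an open disjoint union, so the
  integral can pass from \<open>lebesgue\<close> to \<open>lborel\<close>, where translation
  invariance moves every piece back to \<open>D\<close>.\<close>

lemma integral_finite_Union_translates:
  fixes D \<Omega> :: "'a::euclidean_space set" and f :: "'a \<Rightarrow> complex"
  assumes D: "open D" and P: "finite P"
    and disj: "\<And>p q x y. p \<in> P \<Longrightarrow> q \<in> P \<Longrightarrow> x \<in> D \<Longrightarrow> y \<in> D \<Longrightarrow> p + x = q + y \<Longrightarrow> p = q"
    and \<Omega>: "\<Omega> \<in> lmeasurable" "(\<Union>p\<in>P. (+) p ` D) \<subseteq> \<Omega>" "negligible (\<Omega> - (\<Union>p\<in>P. (+) p ` D))"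
    and f: "continuous_on UNIV f" "\<And>x. norm (f x) \<le> B"
  shows "(\<integral>x. f x \<partial>lebesgue_on \<Omega>) = (\<Sum>p\<in>P. \<integral>x. indicator D x *\<^sub>R f (p + x) \<partial>lborel)"
proof -
  define U where "U = (\<Union>p\<in>P. (+) p ` D)"
  have opU: "open U" unfolding U_def using D by (intro open_UN ballI open_translation) 
  have [measurable]: "U \<in> sets borel" "D \<in> sets borel" using opU D by auto
  have [measurable]: "f \<in> borel_measurable borel" using f(1) by (rule borel_measurable_continuous_onI)
  have opT: "open ((+) p ` D)" for p using D by (rule open_translation)
  have "(\<integral>x. f x \<partial>lebesgue_on \<Omega>) = (\<integral>x. indicator \<Omega> x *\<^sub>R f x \<partial>lebesgue)"
    using \<Omega> by (intro integral_restrict_space) auto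
  also have "\<dots> = (\<integral>x. indicator U x *\<^sub>R f x \<partial>lebesgue)"
  proof (rule integral_cong_AE)
    have "AE x in lebesgue. x \<notin> \<Omega> - U"
      using \<Omega>(3) AE_not_in negligible_iff_null_sets unfolding U_def by blast
    then show "AE x in lebesgue. indicator \<Omega> x *\<^sub>R f x = indicator U x *\<^sub>R f x"
      by eventually_elim (use \<Omega>(2) in \<open>auto simp: indicator_def U_def\<close>)
    have "f \<in> borel_measurable lebesgue"
      using \<open>f \<in> borel_measurable borel\<close> by (simp add: measurable_completion)
    moreover have "\<Omega> \<in> sets lebesgue" "U \<in> sets lebesgue" using \<Omega> opU by auto
    ultimately show "(\<lambda>x. indicator \<Omega> x *\<^sub>R f x) \<in> borel_measurable lebesgue"
      "(\<lambda>x. indicator U x *\<^sub>R f x) \<in> borel_measurable lebesgue"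
      by (auto intro!: borel_measurable_scaleR borel_measurable_indicator)
  qed
  also have "\<dots> = (\<integral>x. indicator U x *\<^sub>R f x \<partial>lborel)"
    by (rule integral_completion) measurable
  also have "\<dots> = (\<integral>x. (\<Sum>p\<in>P. indicator ((+) p ` D) x *\<^sub>R f x) \<partial>lborel)"
  proof (rule Bochner_Integration.integral_cong[OF refl])
    fix x
    have "indicator U x = (\<Sum>p\<in>P. indicator ((+) p ` D) x :: real)"
      unfolding U_def using disj P
      by (intro indicator_UN_disjoint) (auto simp: disjoint_family_on_def)
    then show "indicator U x *\<^sub>R f x = (\<Sum>p\<in>P. indicator ((+) p ` D) x *\<^sub>R f x)"
      by (simp add: scaleR_sum_left)
  qed
  also have "\<dots> = (\<Sum>p\<in>P. \<integral>x. indicator ((+) p ` D) x *\<^sub>R f x \<partial>lborel)"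
  proof (rule Bochner_Integration.integral_sum)
    fix p assume p: "p \<in> P"
    have "emeasure lborel ((+) p ` D) \<le> emeasure lebesgue \<Omega>"
    proof -
      have "emeasure lborel ((+) p ` D) = emeasure lebesgue ((+) p ` D)"
        using opT by simp
      also have "\<dots> \<le> emeasure lebesgue \<Omega>"
        using \<Omega>(1,2) p by (intro emeasure_mono) auto
      finally show ?thesis .
    qed
    also have "\<dots> < \<infinity>" using fmeasurableD2[OF \<Omega>(1)] by (simp add: less_top)
    finally have "emeasure lborel ((+) p ` D) < \<infinity>" .
    then show "integrable lborel (\<lambda>x. indicator ((+) p ` D) x *\<^sub>R f x)"
      using opT[of p] f(2) by (intro integrableI_bounded_set_indicator[where B = B]) (auto intro!: AE_I2)
  qed
  also have "\<dots> = (\<Sum>p\<in>P. \<integral>x. indicator D x *\<^sub>R f (p + x) \<partial>lborel)"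
  proof (rule sum.cong[OF refl])
    fix p
    have [measurable]: "(+) p ` D \<in> sets borel" using opT by auto
    have "(\<integral>x. indicator ((+) p ` D) x *\<^sub>R f x \<partial>lborel)
      = (\<integral>x. indicator ((+) p ` D) x *\<^sub>R f x \<partial>distr lborel borel ((+) p))"
      by (simp add: lborel_distr_plus)
    also have "\<dots> = (\<integral>x. indicator ((+) p ` D) (p + x) *\<^sub>R f (p + x) \<partial>lborel)"
      by (rule integral_distr) measurable
    also have "\<dots> = (\<integral>x. indicator D x *\<^sub>R f (p + x) \<partial>lborel)"
      by (intro Bochner_Integration.integral_cong) (auto simp: indicator_def)
    finally show "(\<integral>x. indicator ((+) p ` D) x *\<^sub>R f x \<partial>lborel) = \<dots>" .
  qed
  finally show ?thesis .
qed

section \<open>Periodization over the integer lattice\<close>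

lemma finite_int_lattice_bounded:
  fixes B :: "(real ^ 'n::finite) set"
  assumes "bounded B"
  shows "finite (int_lattice \<inter> B)"
proof -
  obtain r where r: "\<And>x. x \<in> B \<Longrightarrow> norm x \<le> r" using assms by (auto simp: bounded_iff)
  define I where "I = {k :: int. \<bar>real_of_int k\<bar> \<le> r}"
  have "I \<subseteq> {-\<lceil>r\<rceil>..\<lceil>r\<rceil>}" unfolding I_def by (auto; linarith)
  then have fI: "finite I" by (rule finite_subset) simp
  have "int_lattice \<inter> B \<subseteq> (\<lambda>k. (\<chi> i. of_int (k i))) ` PiE UNIV (\<lambda>_. I)"
  proof
    fix z assume z: "z \<in> int_lattice \<inter> B"
    then have "z = (\<chi> i. of_int \<lfloor>z $ i\<rfloor>)"
      by (auto simp: vec_eq_iff int_lattice_def elim: Ints_cases)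
    moreover have "\<lfloor>z $ i\<rfloor> \<in> I" for i
    proof -
      have "\<bar>z $ i\<bar> \<le> r" using r[of z] z component_le_norm_cart[of z i] by auto
      moreover obtain m where "z $ i = of_int m" using z by (auto simp: int_lattice_def elim: Ints_cases)
      ultimately show ?thesis by (simp add: I_def)
    qed
    ultimately show "z \<in> (\<lambda>k. (\<chi> i. of_int (k i))) ` PiE UNIV (\<lambda>_. I)"
      by (intro image_eqI[of _ _ "\<lambda>i. \<lfloor>z $ i\<rfloor>"]) auto
  qed
  moreover have "finite (PiE (UNIV :: 'n set) (\<lambda>_. I))" using fI by (intro finite_PiE) auto
  ultimately show ?thesis by (meson finite_imageI finite_subset)
qed

text \<open>The index set varies with \<open>x\<close>, but for \<open>x\<close> near
  \<open>x0\<close> it stays inside one finite set \<open>T\<close> and the additional terms are 0.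
  Locally the sum is therefore a fixed finite sum of continuous functions.\<close>

lemma continuous_on_periodization:
  fixes w :: "real ^ 'n::finite \<Rightarrow> complex"
  assumes "bounded U" "continuous_on UNIV w" "\<And>x. x \<notin> U \<Longrightarrow> w x = 0"
  shows "continuous_on UNIV (\<lambda>x. \<Sum>z\<in>{z\<in>int_lattice. x + z \<in> U}. w (x + z))"
  unfolding continuous_on_eq_continuous_within
proof
  fix x0 :: "real ^ 'n"
  define T where "T = int_lattice \<inter> {u - x | u x. u \<in> U \<and> x \<in> ball x0 1}"
  have "bounded {u - x | u x. u \<in> U \<and> x \<in> ball x0 1}"
  proof -
    obtain r where r: "\<And>u. u \<in> U \<Longrightarrow> norm u \<le> r" using assms(1) by (auto simp: bounded_iff)
    have "norm (u - x) \<le> r + (norm x0 + 1)" if "u \<in> U" "x \<in> ball x0 1" for u x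
    proof -
      have "norm (u - x) \<le> norm u + norm x" by (rule norm_triangle_ineq4)
      moreover have "norm x \<le> norm x0 + norm (x - x0)" using norm_triangle_sub[of x x0] by simp
      moreover have "norm (x - x0) < 1" using that by (simp add: dist_norm norm_minus_commute)
      ultimately show ?thesis using r[OF that(1)] by linarith
    qed
    then show ?thesis unfolding bounded_iff by blast
  qed
  then have T: "finite T" unfolding T_def by (rule finite_int_lattice_bounded)
  have eq: "(\<Sum>z\<in>T. w (x + z)) = (\<Sum>z\<in>{z\<in>int_lattice. x + z \<in> U}. w (x + z))"
    if "x \<in> ball x0 1" for x
  proof (rule sum.mono_neutral_right)
    show "{z \<in> int_lattice. x + z \<in> U} \<subseteq> T"
    proof
      fix z assume "z \<in> {z \<in> int_lattice. x + z \<in> U}"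
      then have "z \<in> int_lattice" "x + z \<in> U" by auto
      moreover have "z = (x + z) - x" by simp
      ultimately show "z \<in> T" using that unfolding T_def by blast
    qed
    show "\<forall>z\<in>T - {z \<in> int_lattice. x + z \<in> U}. w (x + z) = 0"
      using assms(3) by (auto simp: T_def)
  qed (rule T)
  have "continuous_on UNIV (\<lambda>x. \<Sum>z\<in>T. w (x + z))"
    by (intro continuous_intros continuous_on_compose2[OF assms(2)]) auto
  then have "continuous_on (ball x0 1) (\<lambda>x. \<Sum>z\<in>T. w (x + z))"
    by (rule continuous_on_subset) auto
  then have "continuous_on (ball x0 1) (\<lambda>x. \<Sum>z\<in>{z\<in>int_lattice. x + z \<in> U}. w (x + z))"
    by (rule continuous_on_eq) (use eq in auto)
  then show "continuous (at x0 within UNIV) (\<lambda>x. \<Sum>z\<in>{z\<in>int_lattice. x + z \<in> U}. w (x + z))"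
    by (simp add: continuous_on_eq_continuous_at)
qed

lemma sum_int_lattice_periodic:
  fixes w :: "real ^ 'n \<Rightarrow> complex"
  assumes "k \<in> int_lattice"
  shows "(\<Sum>z\<in>{z\<in>int_lattice. x + k + z \<in> U}. w (x + k + z)) = (\<Sum>z\<in>{z\<in>int_lattice. x + z \<in> U}. w (x + z))"
proof (rule sum.reindex_bij_witness[of _ "\<lambda>z. z - k" "\<lambda>z. z + k"])
qed (use assms in \<open>auto simp: algebra_simps\<close>)

text \<open>\<open>D_inj\<close> is the packing half of being a fundamental domain.
  \<open>D_orth\<close> encodes the covering half: the nonzero Fourier coefficients of the
  periodized indicator vanish, so it is constant almost everywhere. \<open>row\<close> and
  \<open>col\<close> say that the matrix \<open>fourier_exp s p\<close> is unitary up to scaling;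
  rows give orthogonality of the exponentials, columns their completeness. \<open>\<Omega>\<close>
  may exceed the union by a null set, which leaves room to glue the pieces together.\<close>

locale lattice_tile_union =
  fixes D \<Omega> :: "(real ^ 'n::finite) set" and P S :: "(real ^ 'n) set"
  assumes D: "open D" "bounded D" "D \<noteq> {}"
    and D_inj: "\<And>x y. x \<in> D \<Longrightarrow> y \<in> D \<Longrightarrow> x - y \<in> int_lattice \<Longrightarrow> x = y"
    and D_orth: "\<And>z. z \<in> int_lattice \<Longrightarrow> z \<noteq> 0 \<Longrightarrow> (\<integral>x. indicator D x *\<^sub>R fourier_exp z x \<partial>lborel) = 0"
    and P: "finite P" "P \<noteq> {}" "P \<subseteq> int_lattice"
    and S: "finite S" "S \<noteq> {}"
    and col: "\<And>p q. p \<in> P \<Longrightarrow> q \<in> P \<Longrightarrow> p \<noteq> q \<Longrightarrow> (\<Sum>s\<in>S. fourier_exp s (p - q)) = 0"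
    and row: "\<And>s t. s \<in> S \<Longrightarrow> t \<in> S \<Longrightarrow> s \<noteq> t \<Longrightarrow> (\<Sum>p\<in>P. fourier_exp (s - t) p) = 0"
    and \<Omega>: "\<Omega> \<in> lmeasurable" "(\<Union>p\<in>P. (+) p ` D) \<subseteq> \<Omega>" "negligible (\<Omega> - (\<Union>p\<in>P. (+) p ` D))"
begin

definition "U = (\<Union>p\<in>P. (+) p ` D)"

lemma open_U: "open U"
  unfolding U_def using D by (intro open_UN ballI open_translation)

lemma bounded_U: "bounded U"
  unfolding U_def using D P by (intro bounded_UN ballI bounded_translation) auto

lemma measure_pos: "0 < measure lebesgue \<Omega>"
proof -
  have "U \<noteq> {}" using D P by (auto simp: U_def)
  then have "\<not> negligible U" using open_U open_not_negligible by blast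
  then have "\<not> negligible \<Omega>" using \<Omega>(2) negligible_subset unfolding U_def by blast
  then show ?thesis using \<Omega>(1)
    by (metis measure_nonneg negligible_iff_measure0 order_le_less)
qed

lemma fourier_exp_L2:
  "fourier_exp l \<in> L2_fun (lebesgue_on \<Omega>)" "L2_norm (lebesgue_on \<Omega>) (fourier_exp l) \<noteq> 0"
proof -
  interpret finite_measure "lebesgue_on \<Omega>"
    using \<Omega>(1) by (rule finite_measure_lebesgue_on)
  have "fourier_exp l \<in> borel_measurable (lebesgue_on \<Omega>)"
    using \<Omega>(1) by (intro continuous_imp_measurable_on_sets_lebesgue)
      (auto intro!: continuous_on_fourier_exp continuous_on_id)
  then show "fourier_exp l \<in> L2_fun (lebesgue_on \<Omega>)" by (simp add: L2_fun_def)
  have "measure (lebesgue_on \<Omega>) (space (lebesgue_on \<Omega>)) = measure lebesgue \<Omega>"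
    using \<Omega>(1) by (simp add: measure_restrict_space fmeasurableD)
  then show "L2_norm (lebesgue_on \<Omega>) (fourier_exp l) \<noteq> 0"
    using measure_pos by (simp add: L2_norm_def)
qed

lemma P_disjoint:
  "p \<in> P \<Longrightarrow> q \<in> P \<Longrightarrow> x \<in> D \<Longrightarrow> y \<in> D \<Longrightarrow> p + x = q + y \<Longrightarrow> p = q"
proof -
  assume a: "p \<in> P" "q \<in> P" "x \<in> D" "y \<in> D" "p + x = q + y"
  then have "x - y = q - p" by (simp add: algebra_simps)
  then have "x - y \<in> int_lattice" using a P(3) by auto
  with a D_inj show "p = q" by force
qed

text \<open>The integral over the union factors into a sum over \<open>P\<close> and an integral
  over \<open>D\<close>. If \<open>s = t\<close>, the frequency difference is a nonzero lattice
  vector and \<open>D_orth\<close> kills the second factor. Otherwise its lattice part is invisible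
  on \<open>P\<close> and \<open>row\<close> kills the first.\<close>

lemma fourier_exp_orthogonal:
  assumes "s \<in> S" "t \<in> S" "y \<in> int_lattice" "z \<in> int_lattice" "s + y \<noteq> t + z"
  shows "L2_inner (lebesgue_on \<Omega>) (fourier_exp (s + y)) (fourier_exp (t + z)) = 0"
proof -
  define v where "v = (s + y) - (t + z)"
  have "L2_inner (lebesgue_on \<Omega>) (fourier_exp (s + y)) (fourier_exp (t + z))
      = (\<integral>x. fourier_exp v x \<partial>lebesgue_on \<Omega>)"
    by (simp add: L2_inner_def v_def cnj_fourier_exp fourier_exp_add_left[symmetric] algebra_simps)
  also have "\<dots> = (\<Sum>p\<in>P. \<integral>x. indicator D x *\<^sub>R fourier_exp v (p + x) \<partial>lborel)"
    using D P \<Omega> P_disjoint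
    by (intro integral_finite_Union_translates[where B = 1]) (auto intro!: continuous_on_fourier_exp continuous_on_id)
  also have "\<dots> = (\<Sum>p\<in>P. fourier_exp v p * (\<integral>x. indicator D x *\<^sub>R fourier_exp v x \<partial>lborel))"
    by (simp add: fourier_exp_add_right mult_scaleR_right[symmetric] del: mult_scaleR_right)
  also have "\<dots> = (\<Sum>p\<in>P. fourier_exp v p) * (\<integral>x. indicator D x *\<^sub>R fourier_exp v x \<partial>lborel)"
    by (simp add: sum_distrib_right)
  also have "\<dots> = 0"
  proof (cases "s = t")
    case True
    then have "v = y - z" "v \<noteq> 0" using assms by (auto simp: v_def)
    then show ?thesis using D_orth[of v] assms by simp
  next
    case False
    have "fourier_exp v p = fourier_exp (s - t) p" if "p \<in> P" for p
    proof -
      have "v = (s - t) + (y - z)" by (simp add: v_def)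
      moreover have "fourier_exp (y - z) p = 1"
        using that P(3) assms by (intro fourier_exp_eq_1 inner_int_lattice) auto
      ultimately show ?thesis by (simp add: fourier_exp_add_left)
    qed
    then show ?thesis using row[OF assms(1,2) False] by simp
  qed
  finally show ?thesis .
qed

text \<open>By \<open>D_inj\<close> a lattice translate of \<open>q + d\<close> that lies in
  \<open>U\<close> has the same component \<open>d\<close> in \<open>D\<close>, so a periodization
  at \<open>q + d\<close> sees exactly the points \<open>p + d\<close>.\<close>

lemma lattice_points_of_U:
  assumes "q \<in> P" "d \<in> D"
  shows "{z\<in>int_lattice. q + d + z \<in> U} = (\<lambda>p. p - q) ` P"
proof (intro equalityI subsetI)
  fix z assume z: "z \<in> {z\<in>int_lattice. q + d + z \<in> U}"
  then obtain p d' where p: "p \<in> P" "d' \<in> D" "q + d + z = p + d'" by (auto simp: U_def)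
  then have "d' - d = q + z - p" by (simp add: algebra_simps)
  also have "\<dots> \<in> int_lattice" using p z assms P(3) by auto
  finally have "d' = d" using D_inj p assms by blast
  then have "z = p - q" using p by (simp add: algebra_simps)
  then show "z \<in> (\<lambda>p. p - q) ` P" using p by blast
next
  fix z assume "z \<in> (\<lambda>p. p - q) ` P"
  then show "z \<in> {z\<in>int_lattice. q + d + z \<in> U}"
    using assms P(3) by (auto simp: U_def intro!: bexI image_eqI[of _ _ d])
qed

text \<open>Each \<open>H s\<close> below is a periodization, hence uniformly approximable by trigonometric polynomials, and
  orthogonality of the columns of \<open>(fourier_exp s p)\<close> recovers \<open>G\<close> on \<open>U\<close> as \<open>\<Sum>s\<in>S. H s x * fourier_exp s x\<close>.\<close>

lemma uniform_approximation:
  assumes G: "continuous_on UNIV G" "\<And>x. x \<notin> U \<Longrightarrow> G x = 0" and "0 < \<epsilon>"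
  obtains p where "fourier_span {s + z | s z. s \<in> S \<and> z \<in> int_lattice} p"
    "\<And>x. x \<in> U \<Longrightarrow> norm (G x - p x) \<le> \<epsilon>"
proof -
  let ?c = "of_nat (card S) :: complex"
  have c0: "?c \<noteq> 0" using S by auto
  define w where "w s x = G x * fourier_exp (- s) x / ?c" for s x
  define H where "H s x = (\<Sum>z\<in>{z\<in>int_lattice. x + z \<in> U}. w s (x + z))" for s x
  have contH: "continuous_on UNIV (H s)" for s
    unfolding H_def
  proof (rule continuous_on_periodization[OF bounded_U])
    show "continuous_on UNIV (w s)" unfolding w_def
      using c0 by (intro continuous_intros G) auto
  qed (auto simp: w_def G)
  have perH: "H s (x + z) = H s x" if "z \<in> int_lattice" for s x z
    unfolding H_def by (rule sum_int_lattice_periodic[OF that])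
  define \<eta> where "\<eta> = \<epsilon> / card S"
  have "0 < \<eta>" using S \<open>0 < \<epsilon>\<close> by (simp add: \<eta>_def card_gt_0_iff)
  have "\<exists>p. trig_poly p \<and> (\<forall>x. norm (H s x - p x) < \<eta>)" for s
    using trig_poly_approximation[OF contH perH \<open>0 < \<eta>\<close>, of s] by metis
  then obtain p where p: "\<And>s. trig_poly (p s)" "\<And>s x. norm (H s x - p s x) < \<eta>" by metis
  define q where "q x = (\<Sum>s\<in>S. p s x * fourier_exp s x)" for x
  have "fourier_span {s + z | s z. s \<in> S \<and> z \<in> int_lattice} q"
    unfolding q_def
  proof (rule fourier_span_sum)
    show "{s + z | s z. s \<in> S \<and> z \<in> int_lattice} \<noteq> {}" using S by auto
    fix s assume "s \<in> S"
    then show "fourier_span {s + z | s z. s \<in> S \<and> z \<in> int_lattice} (\<lambda>x. p s x * fourier_exp s x)"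
      by (intro fourier_span_mono[OF fourier_span_shift[OF p(1)]]) auto
  qed
  moreover have "norm (G x - q x) \<le> \<epsilon>" if "x \<in> U" for x
  proof -
    from that obtain r d where r: "r \<in> P" "d \<in> D" "x = r + d" by (auto simp: U_def)
    have Hx: "H s x = (\<Sum>p\<in>P. w s (p + d))" for s
      unfolding H_def r(3) lattice_points_of_U[OF r(1,2)]
      by (subst sum.reindex) (auto simp: inj_on_def algebra_simps)
    have "(\<Sum>s\<in>S. H s x * fourier_exp s x)
        = (\<Sum>s\<in>S. \<Sum>p\<in>P. G (p + d) / ?c * fourier_exp s (r - p))"
      unfolding Hx sum_distrib_right
    proof (intro sum.cong refl)
      fix s p
      have "fourier_exp (- s) (p + d) * fourier_exp s x = fourier_exp s (- (p + d) + x)"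
        by (simp only: fourier_exp_add_right fourier_exp_minus_right)
      also have "- (p + d) + x = r - p" by (simp add: r)
      finally show "w s (p + d) * fourier_exp s x = G (p + d) / ?c * fourier_exp s (r - p)"
        by (simp add: w_def)
    qed
    also have "\<dots> = (\<Sum>p\<in>P. G (p + d) / ?c * (\<Sum>s\<in>S. fourier_exp s (r - p)))"
      by (subst sum.swap) (simp add: sum_distrib_left)
    also have "\<dots> = (\<Sum>p\<in>P. if p = r then G (p + d) else 0)"
      using c0 col[OF r(1)] by (intro sum.cong refl) auto
    also have "\<dots> = G x" using P(1) r by simp
    finally have "G x - q x = (\<Sum>s\<in>S. (H s x - p s x) * fourier_exp s x)"
      by (simp add: q_def sum_subtractf left_diff_distrib)
    also have "norm \<dots> \<le> (\<Sum>s\<in>S. \<eta>)"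
      by (rule sum_norm_le) (simp add: norm_mult less_imp_le p)
    also have "\<dots> = \<epsilon>" using S by (simp add: \<eta>_def)
    finally show ?thesis .
  qed
  ultimately show ?thesis using that by blast
qed

lemma L2_approximation:
  assumes f: "f \<in> L2_fun (lebesgue_on \<Omega>)" and "0 < \<epsilon>"
  obtains p where "fourier_span {s + z | s z. s \<in> S \<and> z \<in> int_lattice} p"
    "L2_norm (lebesgue_on \<Omega>) (\<lambda>x. f x - p x) < \<epsilon>"
proof -
  let ?M = "lebesgue_on \<Omega>"
  interpret finite_measure ?M
    using \<Omega>(1) by (rule finite_measure_lebesgue_on)
  have neq: "U \<noteq> UNIV" using bounded_U not_bounded_UNIV by auto
  obtain G B where G: "continuous_on UNIV G" "\<And>x. x \<notin> U \<Longrightarrow> G x = 0" "\<And>x. norm (G x) \<le> B"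
    and fG: "(\<integral>x. (norm (f x - G x))\<^sup>2 \<partial>?M) < \<epsilon>\<^sup>2 / 4"
  proof (rule L2_approx_continuous[OF open_U _ neq \<Omega>(1) _ f, of "\<epsilon>\<^sup>2 / 4"])
    show "U \<subseteq> \<Omega>" "negligible (\<Omega> - U)" using \<Omega> by (simp_all add: U_def)
    show "0 < \<epsilon>\<^sup>2 / 4" using \<open>0 < \<epsilon>\<close> by simp
  qed blast
  define m where "m = measure lebesgue \<Omega>"
  have m: "0 < m" using measure_pos by (simp add: m_def)
  have space_m: "measure ?M \<Omega> = m"
    using \<Omega>(1) by (simp add: measure_restrict_space fmeasurableD m_def)
  \<comment> \<open>The summand 1 makes \<open>\<eta> * sqrt m\<close> strictly smaller than
    \<open>\<epsilon> / 2\<close>. Each of the two squared errors may be at most a quarter of the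
    target since \<open>norm_diff_squared_triangle\<close> doubles them.\<close>
  define \<eta> where "\<eta> = \<epsilon> / (2 * (sqrt m + 1))"
  have \<eta>: "0 < \<eta>" "\<eta>\<^sup>2 * m < \<epsilon>\<^sup>2 / 4"
  proof -
    show "0 < \<eta>" using m \<open>0 < \<epsilon>\<close> by (simp add: \<eta>_def add_pos_pos)
    have "\<eta> * sqrt m < \<epsilon> / 2"
      using m \<open>0 < \<epsilon>\<close> by (simp add: \<eta>_def field_simps add_pos_pos)
    then have "(\<eta> * sqrt m)\<^sup>2 < (\<epsilon> / 2)\<^sup>2"
      using \<open>0 < \<eta>\<close> m by (intro power_strict_mono) auto
    then show "\<eta>\<^sup>2 * m < \<epsilon>\<^sup>2 / 4" using m by (simp add: power_mult_distrib power_divide)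
  qed
  obtain p where p: "fourier_span {s + z | s z. s \<in> S \<and> z \<in> int_lattice} p"
    and Gp: "\<And>x. x \<in> U \<Longrightarrow> norm (G x - p x) \<le> \<eta>"
    using uniform_approximation[OF G(1,2) \<eta>(1)] by blast
  have contp: "continuous_on UNIV p"
    using p by (induction p rule: fourier_span.induct)
      (auto intro!: continuous_intros continuous_on_fourier_exp continuous_on_id)
  have [measurable]: "f \<in> borel_measurable ?M" and int_f: "integrable ?M (\<lambda>x. (norm (f x))\<^sup>2)"
    using f by (auto simp: L2_fun_def)
  have [measurable]: "G \<in> borel_measurable ?M" "p \<in> borel_measurable ?M"
    using \<Omega>(1) G(1) contp by (auto intro!: continuous_imp_measurable_on_sets_lebesgue
      intro: continuous_on_subset)
  have i0: "integrable ?M (\<lambda>x. (norm (G x))\<^sup>2)"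
    by (rule integrable_const_bound[where B = "B\<^sup>2"]) (auto intro!: AE_I2 power_mono G)
  have i1: "integrable ?M (\<lambda>x. (norm (f x - G x))\<^sup>2)"
  proof (rule Bochner_Integration.integrable_bound)
    show "integrable ?M (\<lambda>x. 2 * (norm (f x))\<^sup>2 + 2 * (norm (G x))\<^sup>2)"
      using int_f i0 by auto
    show "AE x in ?M. norm ((norm (f x - G x))\<^sup>2) \<le> norm (2 * (norm (f x))\<^sup>2 + 2 * (norm (G x))\<^sup>2)"
      using norm_add_squared_le[of "f x" "- G x" for x] by (intro AE_I2) auto
  qed auto
  have AEU: "AE x in ?M. x \<in> U"
  proof -
    have "AE x in lebesgue. x \<notin> \<Omega> - U"
      using \<Omega>(3) AE_not_in negligible_iff_null_sets unfolding U_def by blast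
    then have "AE x in ?M. x \<notin> \<Omega> - U"
      using \<Omega>(1) by (subst AE_restrict_space_iff) (auto elim: eventually_mono)
    moreover have "AE x in ?M. x \<in> \<Omega>" by (intro AE_I2) simp
    ultimately show ?thesis by eventually_elim auto
  qed
  have bd: "AE x in ?M. (norm (G x - p x))\<^sup>2 \<le> \<eta>\<^sup>2"
    using AEU by eventually_elim (auto intro!: power_mono Gp)
  have i2: "integrable ?M (\<lambda>x. (norm (G x - p x))\<^sup>2)"
    using bd by (intro integrable_const_bound[where B = "\<eta>\<^sup>2"]) auto
  have "(\<integral>x. (norm (G x - p x))\<^sup>2 \<partial>?M) \<le> (\<integral>x. \<eta>\<^sup>2 \<partial>?M)"
    by (rule integral_mono_AE[OF i2 _ bd]) simp
  also have "\<dots> = \<eta>\<^sup>2 * m" by (simp add: space_m)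
  finally have Gp2: "(\<integral>x. (norm (G x - p x))\<^sup>2 \<partial>?M) < \<epsilon>\<^sup>2 / 4" using \<eta>(2) by linarith
  have i3: "integrable ?M (\<lambda>x. 2 * (norm (f x - G x))\<^sup>2 + 2 * (norm (G x - p x))\<^sup>2)"
    using i1 i2 by auto
  have "(\<integral>x. (norm (f x - p x))\<^sup>2 \<partial>?M) \<le> (\<integral>x. 2 * (norm (f x - G x))\<^sup>2 + 2 * (norm (G x - p x))\<^sup>2 \<partial>?M)"
    by (rule Bochner_Integration.integral_mono'[OF i3]) (auto intro: norm_diff_squared_triangle)
  also have "\<dots> = 2 * (\<integral>x. (norm (f x - G x))\<^sup>2 \<partial>?M) + 2 * (\<integral>x. (norm (G x - p x))\<^sup>2 \<partial>?M)"
    using i1 i2 by simp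
  also have "\<dots> < \<epsilon>\<^sup>2" using fG Gp2 by linarith
  finally have "L2_norm ?M (\<lambda>x. f x - p x) < \<epsilon>"
    unfolding L2_norm_def using \<open>0 < \<epsilon>\<close> real_sqrt_less_mono by fastforce
  with p show ?thesis using that by blast
qed

lemma orthogonal_basis:
  "orthogonal_basis_L2 (lebesgue_on \<Omega>) {s + z | s z. s \<in> S \<and> z \<in> int_lattice} fourier_exp"
  unfolding orthogonal_basis_L2_def
proof (intro conjI ballI allI impI)
  fix f \<epsilon> assume "f \<in> L2_fun (lebesgue_on \<Omega>)" "0 < (\<epsilon> :: real)"
  then obtain p where "fourier_span {s + z | s z. s \<in> S \<and> z \<in> int_lattice} p"
    "L2_norm (lebesgue_on \<Omega>) (\<lambda>x. f x - p x) < \<epsilon>" using L2_approximation by blast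
  then show "\<exists>J c. finite J \<and> J \<subseteq> {s + z | s z. s \<in> S \<and> z \<in> int_lattice} \<and>
      L2_norm (lebesgue_on \<Omega>) (\<lambda>x. f x - (\<Sum>j\<in>J. c j * fourier_exp j x)) < \<epsilon>"
    by (elim fourier_span_representation) blast
qed (use fourier_exp_L2 fourier_exp_orthogonal in auto)

lemma spectral_union: "spectral \<Omega>"
  unfolding spectral_def using \<Omega>(1) measure_pos orthogonal_basis by blast

end

section \<open>Integrals and sums of exponentials\<close>

lemma integral_cis_interval:
  fixes a b w :: real
  assumes "a \<le> b"
  shows "(\<integral>u. indicator {a<..<b} u *\<^sub>R cis (2 * pi * (w * u)) \<partial>lborel)
    = (if w = 0 then of_real (b - a) else (cis (2 * pi * (w * b)) - cis (2 * pi * (w * a))) / (2 * of_real pi * \<i> * of_real w))"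
proof -
  define F where "F u = (if w = 0 then of_real u else cis (2 * pi * (w * u)) / (2 * of_real pi * \<i> * of_real w))" for u
  have "(\<integral>u. indicator {a<..<b} u *\<^sub>R cis (2 * pi * (w * u)) \<partial>lborel)
      = (\<integral>u. indicator {a..b} u *\<^sub>R cis (2 * pi * (w * u)) \<partial>lborel)"
  proof (rule integral_cong_AE)
    have "AE u in lborel. u \<noteq> a" "AE u in lborel. u \<noteq> b" by (rule AE_lborel_singleton)+
    then show "AE u in lborel. indicator {a<..<b} u *\<^sub>R cis (2 * pi * (w * u)) = indicator {a..b} u *\<^sub>R cis (2 * pi * (w * u))"
      by eventually_elim (auto simp: indicator_def)
  qed (unfold cis_conv_exp, measurable)
  also have "\<dots> = F b - F a"
  proof (rule integral_FTC_Icc[OF assms])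
    fix u
    have "(F has_vector_derivative cis (2 * pi * (w * u))) (at u within {a..b})"
    proof (cases "w = 0")
      case True
      then show ?thesis unfolding F_def
        by (auto intro!: derivative_eq_intros simp: has_vector_derivative_def fun_eq_iff scaleR_conv_of_real)
    next
      case False
      define c where "c = 2 * of_real pi * \<i> * of_real w"
      have "c \<noteq> 0" using False by (simp add: c_def)
      have cis: "cis (2 * pi * (w * v)) = exp (c * of_real v)" for v
        by (simp add: c_def cis_conv_exp mult_ac)
      have "((\<lambda>z. exp (c * z) / c) has_field_derivative exp (c * of_real u)) (at (of_real u))"
        using \<open>c \<noteq> 0\<close> by (auto intro!: derivative_eq_intros)
      from has_vector_derivative_real_field[OF this] show ?thesis
        using False by (simp add: F_def[abs_def] cis c_def[symmetric])
    qed
    then show "(F has_vector_derivative cis (2 * pi * (w * u))) (at u within {a..b})" .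
  next
    show "continuous_on {a..b} (\<lambda>u. cis (2 * pi * (w * u)))"
      unfolding cis_conv_exp by (intro continuous_intros)
  qed
  finally show ?thesis by (simp add: F_def diff_divide_distrib)
qed

lemma cis_sum: "finite B \<Longrightarrow> cis (\<Sum>m\<in>B. g m) = (\<Prod>m\<in>B. cis (g m))"
  by (induction B rule: finite_induct) (simp_all flip: cis_mult)

lemma Basis_real_vec: "(Basis :: (real ^ 'n) set) = (\<lambda>i. axis i 1) ` UNIV"
  by (auto simp: Basis_vec_def)

lemma inj_axis_1: "inj (\<lambda>i. axis i (1 :: real) :: real ^ 'n)"
  by (auto simp: inj_def axis_eq_axis)

lemma integral_fourier_exp_box:
  fixes a b z :: "real ^ 'n::finite"
  shows "(\<integral>x. indicator (box a b) x *\<^sub>R fourier_exp z x \<partial>lborel)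
    = (\<Prod>i\<in>UNIV. \<integral>u. indicator {a $ i<..<b $ i} u *\<^sub>R cis (2 * pi * (z $ i * u)) \<partial>lborel)"
proof -
  interpret product_sigma_finite "\<lambda>_ :: real ^ 'n. lborel :: real measure" by standard
  define f where "f c u = indicator {a \<bullet> c<..<b \<bullet> c} u *\<^sub>R cis (2 * pi * (z \<bullet> c * u))" for c :: "real ^ 'n" and u
  have [measurable]: "f c \<in> borel_measurable borel" for c
    unfolding f_def cis_conv_exp by measurable
  have intf: "integrable lborel (f c)" for c
    unfolding f_def
    by (rule integrableI_bounded_set_indicator[where B = 1])
       (auto simp: cis_conv_exp emeasure_bounded_finite[unfolded infinity_ennreal_def] intro!: AE_I2 borel_measurable_continuous_onI continuous_intros)
  have prod: "indicator (box a b) x *\<^sub>R fourier_exp z x = (\<Prod>c\<in>Basis. f c (x \<bullet> c))" for x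
  proof -
    have "(\<Prod>c\<in>Basis. f c (x \<bullet> c)) = (\<Prod>c\<in>Basis. of_real (indicator {a \<bullet> c<..<b \<bullet> c} (x \<bullet> c))) * (\<Prod>c\<in>Basis. cis (2 * pi * (z \<bullet> c * (x \<bullet> c))))"
      by (simp add: f_def scaleR_conv_of_real prod.distrib)
    also have "(\<Prod>c\<in>Basis. of_real (indicator {a \<bullet> c<..<b \<bullet> c} (x \<bullet> c))) = (of_real (indicator (box a b) x) :: complex)"
    proof (cases "x \<in> box a b")
      case True
      then show ?thesis by (simp add: mem_box)
    next
      case False
      then obtain c where "c \<in> Basis" "\<not> (a \<bullet> c < x \<bullet> c \<and> x \<bullet> c < b \<bullet> c)" by (auto simp: mem_box)
      then show ?thesis using False by (auto intro!: prod_zero bexI[of _ c])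
    qed
    also have "(\<Prod>c\<in>Basis. cis (2 * pi * (z \<bullet> c * (x \<bullet> c)))) = fourier_exp z x"
      by (simp add: fourier_exp_eq_cis euclidean_inner[of z x] sum_distrib_left cis_sum)
    finally show ?thesis by (simp add: scaleR_conv_of_real)
  qed
  have "(\<integral>x. indicator (box a b) x *\<^sub>R fourier_exp z x \<partial>lborel) = (\<integral>x. (\<Prod>c\<in>Basis. f c (x \<bullet> c)) \<partial>lborel)"
    by (simp only: prod)
  also have "\<dots> = (\<integral>y. (\<Prod>c\<in>Basis. f c ((\<Sum>b\<in>Basis. y b *\<^sub>R b) \<bullet> c)) \<partial>(\<Pi>\<^sub>M b\<in>Basis. lborel))"
    by (subst lborel_eq) (rule integral_distr; measurable)
  also have "\<dots> = (\<integral>y. (\<Prod>c\<in>Basis. f c (y c)) \<partial>(\<Pi>\<^sub>M b\<in>Basis. lborel))"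
    by (intro Bochner_Integration.integral_cong prod.cong refl) simp
  also have "\<dots> = (\<Prod>c\<in>Basis. \<integral>u. f c u \<partial>lborel)"
    by (rule product_integral_prod) (use intf in auto)
  also have "\<dots> = (\<Prod>i\<in>UNIV. \<integral>u. f (axis i 1) u \<partial>lborel)"
    unfolding Basis_real_vec by (subst prod.reindex[OF inj_axis_1]) simp
  finally show ?thesis by (simp add: f_def inner_axis)
qed

text \<open>The sum is a product of geometric sums over the coordinates. In a coordinate where
  \<open>k\<close> and \<open>k'\<close> differ the ratio is an \<open>M\<close>-th root of unity
  other than 1, so that factor is 0.\<close>

lemma sum_grid_cis:
  fixes k k' :: "nat \<Rightarrow> nat"
  assumes "k \<in> PiE I (\<lambda>_. {..<M})" "k' \<in> PiE I (\<lambda>_. {..<M})" "k \<noteq> k'" "finite I"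
  shows "(\<Sum>t\<in>PiE I (\<lambda>_. {..<M}). \<Prod>m\<in>I. cis (2 * pi * (real (t m) * (real (k m) - real (k' m)) / real M))) = 0"
proof -
  obtain m where m: "m \<in> I" "k m \<noteq> k' m" using assms by (meson PiE_ext)
  define w where "w = cis (2 * pi * ((real (k m) - real (k' m)) / real M))"
  have kM: "k m < M" "k' m < M" using assms m by (auto dest: PiE_mem)
  have "w \<noteq> 1"
  proof
    assume "w = 1"
    define x where "x = (real (k m) - real (k' m)) / real M"
    have "cos (2 * pi * x) = 1" using \<open>w = 1\<close> by (simp add: w_def x_def complex_eq_iff)
    then obtain n :: int where "2 * pi * x = of_int n * 2 * pi"
      by (auto simp: cos_one_2pi_int)
    then have "(real (k m) - real (k' m)) / real M = of_int n" by (simp add: x_def[symmetric])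
    then have "real (k m) - real (k' m) = of_int n * real M" using kM by (simp add: field_simps)
    then have "real_of_int (int (k m) - int (k' m)) = of_int (n * int M)" by simp
    then have eq: "int (k m) - int (k' m) = n * int M" by (simp only: of_int_eq_iff)
    then have "int M dvd int (k m) - int (k' m)" by simp
    moreover have "\<bar>int (k m) - int (k' m)\<bar> < int M" using kM by linarith
    ultimately have "int (k m) - int (k' m) = 0"
      using dvd_imp_le_int[of "int (k m) - int (k' m)" "int M"] by auto
    then show False using m by simp
  qed
  moreover have "w ^ M = 1"
  proof -
    have "w ^ M = cis (2 * pi * (real (k m) - real (k' m)))"
      using kM by (simp add: w_def Complex.DeMoivre)
    also have "\<dots> = 1" by (rule cis_multiple_2pi) simp
    finally show ?thesis .
  qed
  ultimately have z: "(\<Sum>u<M. w ^ u) = 0" by (simp add: geometric_sum)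
  have "(\<Sum>t\<in>PiE I (\<lambda>_. {..<M}). \<Prod>m\<in>I. cis (2 * pi * (real (t m) * (real (k m) - real (k' m)) / real M)))
      = (\<Prod>m\<in>I. \<Sum>u<M. cis (2 * pi * (real u * (real (k m) - real (k' m)) / real M)))"
    using assms(4) by (rule prod_sum_PiE[symmetric]) auto
  also have "\<dots> = 0"
  proof (rule prod_zero[OF assms(4) bexI[OF _ m(1)]])
    show "(\<Sum>u<M. cis (2 * pi * (real u * (real (k m) - real (k' m)) / real M))) = 0"
      using z by (simp add: w_def Complex.DeMoivre mult_ac)
  qed
  finally show ?thesis .
qed

section \<open>The stacked boxes\<close>

lemma box_translation_cart: "(+) p ` box a b = box (p + a) (p + b)" for p a b :: "real ^ 'n"
proof (intro equalityI subsetI)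
  fix x assume "x \<in> box (p + a) (p + b)"
  then have "x - p \<in> box a b" by (auto simp: mem_box_cart algebra_simps)
  then show "x \<in> (+) p ` box a b" by (intro image_eqI[of _ _ "x - p"]) auto
qed (auto simp: mem_box_cart)

text \<open>\<open>h\<close> numbers the axes: 0 is the stacking axis, 1 to 4 carry the finite set,
  and every further axis contributes only a unit interval.\<close>

locale stacked_boxes =
  fixes h :: "'n::finite \<Rightarrow> nat" and M :: nat
  assumes inj_h: "inj h" and range_h: "{..4} \<subseteq> range h" and M_pos: "0 < M"
begin

definition lift :: "(nat \<Rightarrow> real) \<Rightarrow> real ^ 'n" where
  "lift f = (\<chi> j. if h j \<in> {1..4} then f (h j) else 0)"

definition index :: "(nat \<times> (nat \<Rightarrow> nat)) set" where
  "index = {..<6} \<times> grid M"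

definition coord :: "nat \<times> (nat \<Rightarrow> nat) \<Rightarrow> nat \<Rightarrow> int" where
  "coord i m = simplex_pt (fst i) m + 3 * int (snd i m)"

definition pt :: "nat \<times> (nat \<Rightarrow> nat) \<Rightarrow> real ^ 'n" where
  "pt i = lift (\<lambda>m. of_int (coord i m))"

text \<open>The two parts are dual to the two parts of \<open>coord\<close>: thirds pair with the
  simplex points and become integral on multiples of 3, while \<open>1 / (3 * M)\<close> pairs with
  \<open>3 * k\<close> to form the discrete Fourier transform of order \<open>M\<close>.\<close>

definition freq :: "nat \<times> (nat \<Rightarrow> nat) \<Rightarrow> real ^ 'n" where
  "freq i = lift (\<lambda>m. of_int (freq_pt (fst i) m) / 3 + real (snd i m) / (3 * real M))"

lemma lift_nth: "lift f $ j = (if h j \<in> {1..4} then f (h j) else 0)"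
  by (simp add: lift_def)

lemma obtain_index: "m \<le> 4 \<Longrightarrow> \<exists>j. h j = m"
  using range_h by (metis atMost_iff imageE subsetD)

lemma inner_lift: "lift f \<bullet> lift g = (\<Sum>m=1..4. f m * g m)"
proof -
  have "lift f \<bullet> lift g = (\<Sum>j\<in>UNIV. if h j \<in> {1..4} then f (h j) * g (h j) else 0)"
    by (simp add: inner_vec_def lift_def if_distrib cong: if_cong)
  also have "\<dots> = (\<Sum>j\<in>h -` {1..4}. f (h j) * g (h j))"
    by (rule sum.mono_neutral_cong_right) auto
  also have "\<dots> = (\<Sum>m\<in>h ` (h -` {1..4}). f m * g m)"
    using inj_h by (subst sum.reindex) (auto intro: inj_on_subset)
  also have "h ` (h -` {1..4}) = {1..4}"
    using range_h by (auto simp: image_vimage_eq)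
  finally show ?thesis .
qed

lemma index_finite: "finite index" and index_ne: "index \<noteq> {}"
  using M_pos by (auto simp: index_def finite_PiE PiE_eq_empty_iff lessThan_empty_iff)

text \<open>Of the four terms of the inner product one is an integer and disappears. The cross term
  of \<open>t\<close> with the simplex point survives, but it involves neither \<open>s\<close> nor
  \<open>k\<close>, so the sums below still factor.\<close>

lemma fourier_exp_freq_pt:
  "fourier_exp (freq (s, t)) (pt (r, k)) = root3 (phase s r)
     * cis (2 * pi * (\<Sum>m=1..4. real (t m) * of_int (simplex_pt r m) / (3 * real M)))
     * (\<Prod>m=1..4. cis (2 * pi * (real (t m) * real (k m) / real M)))"
proof -
  let ?n = "\<Sum>m=1..4. freq_pt s m * int (k m)"
  have "freq (s, t) \<bullet> pt (r, k) = (\<Sum>m=1..4. of_int (freq_pt s m * simplex_pt r m) / 3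
      + of_int (freq_pt s m * int (k m)) + real (t m) * of_int (simplex_pt r m) / (3 * real M)
      + real (t m) * real (k m) / real M)"
    unfolding freq_def pt_def inner_lift using M_pos
    by (intro sum.cong refl) (simp add: coord_def field_simps)
  also have "\<dots> = of_int (phase s r) / 3 + of_int ?n
      + (\<Sum>m=1..4. real (t m) * of_int (simplex_pt r m) / (3 * real M)) + (\<Sum>m=1..4. real (t m) * real (k m) / real M)"
    by (simp only: sum.distrib phase_def of_int_sum sum_divide_distrib)
  finally have "2 * pi * (freq (s, t) \<bullet> pt (r, k)) = 2 * pi * (of_int (phase s r) / 3) + 2 * pi * of_int ?n
      + 2 * pi * (\<Sum>m=1..4. real (t m) * of_int (simplex_pt r m) / (3 * real M))
      + (\<Sum>m=1..4. 2 * pi * (real (t m) * real (k m) / real M))"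
    by (simp only: ring_distribs sum_distrib_left)
  moreover have "cis (2 * pi * of_int ?n) = 1" by (rule cis_multiple_2pi) (rule Ints_of_int)
  ultimately show ?thesis
    by (simp only: fourier_exp_eq_cis root3_def cis_mult[symmetric] cis_sum finite_atLeastAtMost mult_1_right)
qed

lemma root3_diff: "root3 a * cnj (root3 b) = root3 (a - b)"
  by (simp add: root3_def cis_cnj cis_mult ring_distribs diff_divide_distrib)

lemma cis_diff: "cis (2 * pi * a) * cnj (cis (2 * pi * b)) = cis (2 * pi * (a - b))"
  by (simp add: cis_cnj cis_mult ring_distribs)

text \<open>The cross term \<open>c t\<close> stays with the grid factor. If
  \<open>r \<noteq> r'\<close> the Hadamard factor vanishes, whatever \<open>c\<close> is; if
  \<open>r = r'\<close> the cross terms cancel and the grid sum vanishes.\<close>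

lemma column_orthogonal:
  assumes "i \<in> index" "i' \<in> index" "i \<noteq> i'"
  shows "(\<Sum>a\<in>index. fourier_exp (freq a) (pt i - pt i')) = 0"
proof -
  obtain r k r' k' where i: "i = (r, k)" "i' = (r', k')" by fastforce
  have mem: "r < 6" "r' < 6" "k \<in> grid M" "k' \<in> grid M" using assms by (auto simp: index_def i)
  define c where "c t = cis (2 * pi * ((\<Sum>m=1..4. real (t m) * of_int (simplex_pt r m) / (3 * real M))
      - (\<Sum>m=1..4. real (t m) * of_int (simplex_pt r' m) / (3 * real M))))" for t :: "nat \<Rightarrow> nat"
  define d where "d t = (\<Prod>m=1..4. cis (2 * pi * (real (t m) * (real (k m) - real (k' m)) / real M)))" for t :: "nat \<Rightarrow> nat"
  have e: "fourier_exp (freq (s, t)) (pt i - pt i') = root3 (phase s r - phase s r') * (c t * d t)" for s t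
  proof -
    have "fourier_exp (freq (s, t)) (pt i - pt i')
        = fourier_exp (freq (s, t)) (pt (r, k)) * cnj (fourier_exp (freq (s, t)) (pt (r', k')))"
      unfolding i cnj_fourier_exp fourier_exp_minus_right[symmetric] fourier_exp_add_right[symmetric] by simp
    also have "\<dots> = (root3 (phase s r) * cnj (root3 (phase s r')))
       * (cis (2 * pi * (\<Sum>m=1..4. real (t m) * of_int (simplex_pt r m) / (3 * real M)))
        * cnj (cis (2 * pi * (\<Sum>m=1..4. real (t m) * of_int (simplex_pt r' m) / (3 * real M)))))
       * (\<Prod>m=1..4. cis (2 * pi * (real (t m) * real (k m) / real M)) * cnj (cis (2 * pi * (real (t m) * real (k' m) / real M))))"
      unfolding fourier_exp_freq_pt by (simp only: complex_cnj_mult cnj_prod prod.distrib mult_ac)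
    also have "\<dots> = root3 (phase s r - phase s r') * (c t * d t)"
      unfolding root3_diff cis_diff c_def d_def
      by (simp only: diff_divide_distrib[symmetric] right_diff_distrib[symmetric] mult.assoc)
    finally show ?thesis .
  qed
  have "(\<Sum>a\<in>index. fourier_exp (freq a) (pt i - pt i')) = (\<Sum>s<6. \<Sum>t\<in>grid M. root3 (phase s r - phase s r') * (c t * d t))"
    unfolding index_def sum.cartesian_product by (rule sum.cong) (auto simp: e)
  also have "\<dots> = (\<Sum>s<6. root3 (phase s r - phase s r')) * (\<Sum>t\<in>grid M. c t * d t)"
    by (simp only: sum_product)
  also have "\<dots> = 0"
  proof (cases "r = r'")
    case True
    then have "k \<noteq> k'" using assms i by auto
    then have "(\<Sum>t\<in>grid M. d t) = 0" unfolding d_def using mem by (intro sum_grid_cis) auto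
    moreover have "c t = 1" for t using True by (simp add: c_def)
    ultimately show ?thesis by simp
  next
    case False
    then show ?thesis using phase_column_orthogonal[of r r'] mem by simp
  qed
  finally show ?thesis .
qed

text \<open>Dually, the cross term \<open>c r\<close> stays with the Hadamard factor. It cancels
  when \<open>t = t'\<close>, and when \<open>t \<noteq> t'\<close> the grid sum vanishes by
  itself.\<close>

lemma row_orthogonal:
  assumes "a \<in> index" "a' \<in> index" "a \<noteq> a'"
  shows "(\<Sum>i\<in>index. fourier_exp (freq a - freq a') (pt i)) = 0"
proof -
  obtain s t s' t' where a: "a = (s, t)" "a' = (s', t')" by fastforce
  have mem: "s < 6" "s' < 6" "t \<in> grid M" "t' \<in> grid M" using assms by (auto simp: index_def a)
  define c where "c r = cis (2 * pi * ((\<Sum>m=1..4. real (t m) * of_int (simplex_pt r m) / (3 * real M))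
      - (\<Sum>m=1..4. real (t' m) * of_int (simplex_pt r m) / (3 * real M))))" for r
  define d where "d k = (\<Prod>m=1..4. cis (2 * pi * (real (k m) * (real (t m) - real (t' m)) / real M)))" for k :: "nat \<Rightarrow> nat"
  have e: "fourier_exp (freq a - freq a') (pt (r, k)) = (root3 (phase s r - phase s' r) * c r) * d k" for r k
  proof -
    have "fourier_exp (freq a - freq a') (pt (r, k))
        = fourier_exp (freq (s, t)) (pt (r, k)) * cnj (fourier_exp (freq (s', t')) (pt (r, k)))"
      unfolding a cnj_fourier_exp fourier_exp_add_left[symmetric] by simp
    also have "\<dots> = (root3 (phase s r) * cnj (root3 (phase s' r)))
       * (cis (2 * pi * (\<Sum>m=1..4. real (t m) * of_int (simplex_pt r m) / (3 * real M)))
        * cnj (cis (2 * pi * (\<Sum>m=1..4. real (t' m) * of_int (simplex_pt r m) / (3 * real M)))))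
       * (\<Prod>m=1..4. cis (2 * pi * (real (t m) * real (k m) / real M)) * cnj (cis (2 * pi * (real (t' m) * real (k m) / real M))))"
      unfolding fourier_exp_freq_pt by (simp only: complex_cnj_mult cnj_prod prod.distrib mult_ac)
    also have "\<dots> = root3 (phase s r - phase s' r) * c r * d k"
      unfolding root3_diff cis_diff c_def d_def
      by (simp only: diff_divide_distrib[symmetric] left_diff_distrib[symmetric] mult.assoc mult.commute[of "real (k _)"])
    finally show ?thesis .
  qed
  have "(\<Sum>i\<in>index. fourier_exp (freq a - freq a') (pt i))
      = (\<Sum>r<6. \<Sum>k\<in>grid M. (root3 (phase s r - phase s' r) * c r) * d k)"
    unfolding index_def sum.cartesian_product by (rule sum.cong) (auto simp: e)
  also have "\<dots> = (\<Sum>r<6. root3 (phase s r - phase s' r) * c r) * (\<Sum>k\<in>grid M. d k)"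
    by (simp only: sum_product)
  also have "\<dots> = 0"
  proof (cases "t = t'")
    case True
    then have "s \<noteq> s'" using assms a by auto
    moreover have "c r = 1" for r using True by (simp add: c_def)
    ultimately show ?thesis using phase_row_orthogonal[of s s'] mem by simp
  next
    case False
    then have "(\<Sum>k\<in>grid M. d k) = 0" unfolding d_def using mem by (intro sum_grid_cis) auto
    then show ?thesis by simp
  qed
  finally show ?thesis .
qed

text \<open>For equal points the sum that \<open>column_orthogonal\<close> makes 0 would equal the
  size of \<open>index\<close>.\<close>

lemma inj_pt: "inj_on pt index"
proof (rule inj_onI, rule ccontr)
  fix i i' assume "i \<in> index" "i' \<in> index" "pt i = pt i'" "i \<noteq> i'"
  then show False using column_orthogonal[of i i'] index_finite index_ne by simp
qed

lemma inj_freq: "inj_on freq index"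
proof (rule inj_onI, rule ccontr)
  fix i i' assume "i \<in> index" "i' \<in> index" "freq i = freq i'" "i \<noteq> i'"
  then show False using row_orthogonal[of i i'] index_finite index_ne by simp
qed

text \<open>From layer \<open>l\<close> to layer \<open>l + 1\<close> the unit cubes are shifted by \<open>-1/2\<close> in each of the directions
  \<open>1, \<dots>, 4\<close>, except by \<open>+1/2\<close> in direction \<open>l\<close>. The difference of two points of \<open>pt ` index\<close> whose cubes
  touch across these layers then has entries in \<open>{-1, 0}\<close>, and in \<open>{0, 1}\<close> in direction \<open>l\<close>.\<close>

definition offset :: "nat \<Rightarrow> nat \<Rightarrow> real" where
  "offset l m = (if m \<in> {1..4} then (if m < l then 1 else 0) - real l / 2 else 0)"

definition lower :: "nat \<Rightarrow> real ^ 'n" where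
  "lower l = (\<chi> j. if h j = 0 then real l / 6 else offset l (h j))"

definition upper :: "nat \<Rightarrow> real ^ 'n" where
  "upper l = (\<chi> j. if h j = 0 then (real l + 1) / 6 else offset l (h j) + 1)"

definition cell :: "(real ^ 'n) set" where
  "cell = (\<Union>l<6. box (lower l) (upper l))"

text \<open>Closed boxes contain the facets they share, and the interior of their union keeps the
  relatively open shared pieces. The open cells alone would remain separated by these null
  sets.\<close>

definition body :: "(real ^ 'n) set" where
  "body = interior (\<Union>(i, l)\<in>index \<times> {..<6}. cbox (pt i + lower l) (pt i + upper l))"

lemma lower_less_upper: "lower l $ j < upper l $ j"
  by (simp add: lower_def upper_def divide_strict_right_mono)

lemma pt_int_lattice: "pt i \<in> int_lattice"
  by (simp add: pt_def int_lattice_def lift_nth)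

text \<open>Along the stacking axis two points of \<open>cell\<close> differ by less than 1, so a
  lattice difference vanishes there and both lie in the same layer. That layer has side at most 1 in
  every direction, whatever its shift.\<close>

lemma cell_inj:
  assumes "x \<in> cell" "y \<in> cell" "x - y \<in> int_lattice"
  shows "x = y"
proof -
  obtain l l' where l: "x \<in> box (lower l) (upper l)" "y \<in> box (lower l') (upper l')" "l < 6" "l' < 6"
    using assms by (auto simp: cell_def)
  have nearby: "a = b" if "a - b \<in> \<int>" "\<bar>a - b\<bar> < 1" for a b :: real
    using that Ints_nonzero_abs_less1 by fastforce
  have xl: "lower l $ j < x $ j" "x $ j < upper l $ j" "lower l' $ j < y $ j" "y $ j < upper l' $ j" for j
    using l by (auto simp: mem_box_cart)
  have int: "x $ j - y $ j \<in> \<int>" for j using assms(3) by (auto simp: int_lattice_def)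
  obtain j0 where j0: "h j0 = 0" using obtain_index[of 0] by auto
  have b: "real l / 6 < x $ j0" "x $ j0 < (real l + 1) / 6" "real l' / 6 < y $ j0" "y $ j0 < (real l' + 1) / 6"
    using xl[of j0] j0 by (simp_all add: lower_def upper_def)
  moreover have "real l \<le> 5" "real l' \<le> 5" using l by simp_all
  ultimately have "\<bar>x $ j0 - y $ j0\<bar> < 1" by (auto simp: field_simps)
  then have eq0: "x $ j0 = y $ j0" using nearby int by blast
  then have "real l < real l' + 1" "real l' < real l + 1" using b by auto
  then have ll: "l = l'" by linarith
  show ?thesis
  proof (rule vec_eq_iff[THEN iffD2], rule allI)
    fix j
    show "x $ j = y $ j"
    proof (cases "h j = 0")
      case True
      then have "j = j0" using inj_h j0 by (metis injD)
      then show ?thesis using eq0 by simp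
    next
      case False
      then have "\<bar>x $ j - y $ j\<bar> < 1" using xl[of j] ll by (simp add: lower_def upper_def)
      then show ?thesis using nearby int by blast
    qed
  qed
qed

text \<open>If \<open>z\<close> has a nonzero entry off the stacking axis, each layer integrates to
  0 over a full period in that direction, independently of its shift. Otherwise the shifts do not
  enter at all, and the layer integrals telescope to the integral over a full period of the stacking
  axis.\<close>

lemma cell_orthogonal:
  assumes "z \<in> int_lattice" "z \<noteq> 0"
  shows "(\<integral>x. indicator cell x *\<^sub>R fourier_exp z x \<partial>lborel) = 0"
proof -
  let ?B = "\<lambda>l. box (lower l) (upper l)"
  define I where "I l j = (\<integral>u. indicator {lower l $ j<..<upper l $ j} u *\<^sub>R cis (2 * pi * (z $ j * u)) \<partial>lborel)" for l j
  have le: "lower l $ j \<le> upper l $ j" for l j using lower_less_upper by (rule less_imp_le)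
  have disj: "disjoint_family_on ?B {..<6}"
    unfolding disjoint_family_on_def
  proof (intro ballI impI, rule ccontr)
    fix l l' assume "l \<noteq> l'" "?B l \<inter> ?B l' \<noteq> {}"
    then obtain x where x: "x \<in> ?B l" "x \<in> ?B l'" by blast
    obtain j0 where "h j0 = 0" using obtain_index[of 0] by auto
    then have "real l / 6 < x $ j0" "x $ j0 < (real l + 1) / 6" "real l' / 6 < x $ j0" "x $ j0 < (real l' + 1) / 6"
      using x by (auto simp: mem_box_cart lower_def upper_def dest!: spec[of _ j0])
    then have "real l < real l' + 1" "real l' < real l + 1" by auto
    then show False using \<open>l \<noteq> l'\<close> by linarith
  qed
  have "(\<integral>x. indicator cell x *\<^sub>R fourier_exp z x \<partial>lborel)
      = (\<integral>x. (\<Sum>l<6. indicator (?B l) x *\<^sub>R fourier_exp z x) \<partial>lborel)"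
    unfolding cell_def by (simp add: indicator_UN_disjoint[OF _ disj] scaleR_sum_left)
  also have "\<dots> = (\<Sum>l<6. \<integral>x. indicator (?B l) x *\<^sub>R fourier_exp z x \<partial>lborel)"
  proof (rule Bochner_Integration.integral_sum)
    fix l
    show "integrable lborel (\<lambda>x. indicator (?B l) x *\<^sub>R fourier_exp z x)"
    proof (rule integrableI_bounded_set_indicator[where B = 1])
      show "fourier_exp z \<in> borel_measurable lborel"
        by (simp add: borel_measurable_continuous_onI continuous_on_fourier_exp continuous_on_id)
      show "emeasure lborel (?B l) < \<infinity>" by (intro emeasure_bounded_finite) auto
    qed (auto intro!: AE_I2)
  qed
  also have "\<dots> = (\<Sum>l<6. \<Prod>j\<in>UNIV. I l j)"
    by (simp only: integral_fourier_exp_box I_def)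
  also have "\<dots> = 0"
  proof (cases "\<exists>j. h j \<noteq> 0 \<and> z $ j \<noteq> 0")
    case True
    then obtain j where j: "h j \<noteq> 0" "z $ j \<noteq> 0" by blast
    have "I l j = 0" for l
    proof -
      have "upper l $ j = lower l $ j + 1" using j by (simp add: lower_def upper_def)
      then have "cis (2 * pi * (z $ j * upper l $ j)) = cis (2 * pi * (z $ j * lower l $ j)) * cis (2 * pi * z $ j)"
        by (simp add: cis_mult ring_distribs)
      also have "cis (2 * pi * z $ j) = 1"
        using assms by (intro cis_multiple_2pi) (auto simp: int_lattice_def)
      finally show ?thesis unfolding I_def integral_cis_interval[OF le] using j by simp
    qed
    then have "(\<Prod>j\<in>UNIV. I l j) = 0" for l by (intro prod_zero) auto
    then show ?thesis by (rule sum.neutral[OF ballI])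
  next
    case False
    obtain j0 where j0: "h j0 = 0" using obtain_index[of 0] by auto
    have other: "h j \<noteq> 0" if "j \<noteq> j0" for j using that j0 inj_h by (metis injD)
    define w where "w = z $ j0"
    have "w \<noteq> 0" using assms(2) False other unfolding w_def by (metis vec_eq_iff zero_index)
    have "I l j = 1" if "j \<noteq> j0" for l j
    proof -
      have "z $ j = 0" using False other[OF that] by blast
      then show ?thesis
        unfolding I_def integral_cis_interval[OF le] using other[OF that] by (simp add: lower_def upper_def)
    qed
    then have "(\<Prod>j\<in>UNIV. I l j) = I l j0" for l
      by (subst prod.remove[of _ j0]) auto
    also have "I l j0 = (cis (2 * pi * (w * (real (Suc l) / 6))) - cis (2 * pi * (w * (real l / 6)))) / (2 * of_real pi * \<i> * of_real w)" for l
      unfolding I_def integral_cis_interval[OF le] using j0 \<open>w \<noteq> 0\<close>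
      by (simp add: lower_def upper_def w_def add_ac)
    finally have "(\<Sum>l<6. \<Prod>j\<in>UNIV. I l j)
        = (\<Sum>l<6. cis (2 * pi * (w * (real (Suc l) / 6))) - cis (2 * pi * (w * (real l / 6)))) / (2 * of_real pi * \<i> * of_real w)"
      by (simp only: sum_divide_distrib)
    also have "(\<Sum>l<6. cis (2 * pi * (w * (real (Suc l) / 6))) - cis (2 * pi * (w * (real l / 6)))) = cis (2 * pi * w) - 1"
      by (subst sum_lessThan_telescope) simp
    also have "cis (2 * pi * w) = 1"
      using assms by (intro cis_multiple_2pi) (auto simp: int_lattice_def w_def)
    finally show ?thesis by simp
  qed
  finally show ?thesis .
qed

lemma box_subset_body:
  assumes "i \<in> index" "l < 6"
  shows "box (pt i + lower l) (pt i + upper l) \<subseteq> body"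
  unfolding body_def
proof (rule interior_maximal)
  show "box (pt i + lower l) (pt i + upper l) \<subseteq> (\<Union>(i, l)\<in>index \<times> {..<6}. cbox (pt i + lower l) (pt i + upper l))"
    using assms box_subset_cbox by fastforce
qed (rule open_box)

lemma union_cells: "(\<Union>p\<in>pt ` index. (+) p ` cell) = (\<Union>(i, l)\<in>index \<times> {..<6}. box (pt i + lower l) (pt i + upper l))"
  by (auto simp: cell_def image_UN box_translation_cart)

lemma body_negligible: "negligible (body - (\<Union>p\<in>pt ` index. (+) p ` cell))"
proof (rule negligible_subset)
  show "negligible (\<Union>(i, l)\<in>index \<times> {..<6}. cbox (pt i + lower l) (pt i + upper l) - box (pt i + lower l) (pt i + upper l))"
    using index_finite by (intro negligible_Union) (auto simp: negligible_frontier_interval)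
  show "body - (\<Union>p\<in>pt ` index. (+) p ` cell) \<subseteq> (\<Union>(i, l)\<in>index \<times> {..<6}. cbox (pt i + lower l) (pt i + upper l) - box (pt i + lower l) (pt i + upper l))"
    unfolding union_cells using interior_subset by (fastforce simp: body_def)
qed

lemma bounded_body: "bounded body"
proof -
  have "bounded (\<Union>(i, l)\<in>index \<times> {..<6}. cbox (pt i + lower l) (pt i + upper l))"
    using index_finite by (intro bounded_UN) auto
  then show ?thesis unfolding body_def using interior_subset bounded_subset by blast
qed

lemma open_body: "open body" by (simp add: body_def)

lemma lmeasurable_body: "body \<in> lmeasurable"
  using bounded_body open_body by (rule lmeasurable_open)

sublocale lattice_tile_union cell body "pt ` index" "freq ` index"
proof
  show "open cell" "bounded cell" by (auto simp: cell_def)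
  have "box (lower 0) (upper 0) \<noteq> {}" using lower_less_upper by (simp add: interval_ne_empty_cart)
  then show "cell \<noteq> {}" by (auto simp: cell_def)
  show "finite (pt ` index)" "pt ` index \<noteq> {}" "finite (freq ` index)" "freq ` index \<noteq> {}"
    using index_finite index_ne by auto
  show "pt ` index \<subseteq> int_lattice" using pt_int_lattice by auto
  show "(\<Sum>s\<in>freq ` index. fourier_exp s (p - q)) = 0" if "p \<in> pt ` index" "q \<in> pt ` index" "p \<noteq> q" for p q
    unfolding sum.reindex[OF inj_freq] o_def using that column_orthogonal by auto
  show "(\<Sum>p\<in>pt ` index. fourier_exp (s - t) p) = 0" if "s \<in> freq ` index" "t \<in> freq ` index" "s \<noteq> t" for s t
    unfolding sum.reindex[OF inj_pt] o_def using that row_orthogonal by auto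
  show "(\<Union>p\<in>pt ` index. (+) p ` cell) \<subseteq> body"
    unfolding union_cells using box_subset_body by auto
qed (fact cell_inj cell_orthogonal lmeasurable_body body_negligible)+

end

section \<open>Connectedness of the body\<close>

lemma connected_box_pair:
  fixes a b c d :: "real ^ 'n::finite"
  assumes ab: "\<And>j. a $ j < b $ j" and cd: "\<And>j. c $ j < d $ j" and i: "b $ i = c $ i"
    and overlap: "\<And>j. j \<noteq> i \<Longrightarrow> a $ j < d $ j \<and> c $ j < b $ j"
  obtains T where "connected T" "box a b \<subseteq> T" "box c d \<subseteq> T" "T \<subseteq> interior (cbox a b \<union> cbox c d)"
proof -
  \<comment> \<open>\<open>box m n\<close> is a corridor through the shared piece of the facet: the
    common range in all directions but \<open>i\<close>, and the joint length of both boxes in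
    direction \<open>i\<close>. The points \<open>x\<close> and \<open>y\<close> lie in its
    intersections with the two boxes.\<close>
  define m where "m = (\<chi> j. if j = i then a $ i else max (a $ j) (c $ j))"
  define n where "n = (\<chi> j. if j = i then d $ i else min (b $ j) (d $ j))"
  define x where "x = (\<chi> j. if j = i then (a $ i + b $ i) / 2 else (max (a $ j) (c $ j) + min (b $ j) (d $ j)) / 2)"
  define y where "y = (\<chi> j. if j = i then (c $ i + d $ i) / 2 else (max (a $ j) (c $ j) + min (b $ j) (d $ j)) / 2)"
  have mid: "max (a $ j) (c $ j) < min (b $ j) (d $ j)" if "j \<noteq> i" for j
    using ab[of j] cd[of j] overlap[OF that] by simp
  have x: "x \<in> box a b \<inter> box m n"
    using ab cd i mid by (auto simp: mem_box_cart x_def m_def n_def) (smt (verit) field_sum_of_halves)+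
  have y: "y \<in> box m n \<inter> box c d"
    using ab cd i mid by (auto simp: mem_box_cart y_def m_def n_def) (smt (verit) field_sum_of_halves)+
  define T where "T = box a b \<union> box m n \<union> box c d"
  have "connected T" unfolding T_def
    using x y by (intro connected_Un convex_connected convex_box) auto
  moreover have "T \<subseteq> interior (cbox a b \<union> cbox c d)"
  proof (rule interior_maximal)
    have "box m n \<subseteq> cbox a b \<union> cbox c d"
    proof
      fix z assume z: "z \<in> box m n"
      have zj: "a $ j \<le> z $ j \<and> z $ j \<le> b $ j \<and> c $ j \<le> z $ j \<and> z $ j \<le> d $ j" if "j \<noteq> i" for j
        using z that by (auto simp: mem_box_cart m_def n_def less_imp_le dest!: spec[of _ j])
      have zi: "a $ i < z $ i" "z $ i < d $ i"
        using z by (auto simp: mem_box_cart m_def n_def dest!: spec[of _ i])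
      show "z \<in> cbox a b \<union> cbox c d"
      proof (cases "z $ i \<le> b $ i")
        case True
        then have "z \<in> cbox a b" using zi zj by (auto simp: mem_box_cart) (metis less_imp_le)+
        then show ?thesis by simp
      next
        case False
        then have "z \<in> cbox c d" using zi zj i by (auto simp: mem_box_cart) (metis less_imp_le not_le)+
        then show ?thesis by simp
      qed
    qed
    then show "T \<subseteq> cbox a b \<union> cbox c d" unfolding T_def using box_subset_cbox by blast
  qed (auto simp: T_def)
  ultimately show ?thesis using that[of T] by (auto simp: T_def)
qed

context stacked_boxes
begin

definition centre :: "nat \<times> (nat \<Rightarrow> nat) \<Rightarrow> nat \<Rightarrow> real ^ 'n" where
  "centre i l = pt i + (1 / 2) *\<^sub>R (lower l + upper l)"

abbreviation linked where
  "linked i l i' l' \<equiv> connected_component body (centre i l) (centre i' l')"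

lemma centre_in_box: "centre i l \<in> box (pt i + lower l) (pt i + upper l)"
proof -
  have "lower l $ j < (lower l $ j + upper l $ j) / 2 \<and> (lower l $ j + upper l $ j) / 2 < upper l $ j" for j
    using lower_less_upper[of l j] by (simp add: field_simps)
  then show ?thesis by (auto simp: centre_def mem_box_cart)
qed

lemma linked_if_stacked:
  assumes "i \<in> index" "i' \<in> index" "l < 5"
    and d: "\<And>m. m \<in> {1..4} \<Longrightarrow> coord i m - coord i' m = 0 \<or> coord i m - coord i' m = (if m = l then 1 else -1)"
  shows "linked i l i' (Suc l)"
proof -
  obtain j0 where j0: "h j0 = 0" using obtain_index[of 0] by auto
  have off: "\<bar>pt i $ j + offset l (h j) - (pt i' $ j + offset (Suc l) (h j))\<bar> < 1" for j
  proof (cases "h j \<in> {1..4}")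
    case True
    then consider "coord i (h j) = coord i' (h j)"
      | "coord i (h j) = coord i' (h j) + (if h j = l then 1 else -1)" using d[of "h j"] by fastforce
    then show ?thesis
      by cases (use True in \<open>auto simp: pt_def lift_nth offset_def field_simps\<close>)
  next
    case False
    then show ?thesis by (simp only: pt_def lift_nth offset_def if_not_P) simp
  qed
  obtain T where T: "connected T" "box (pt i + lower l) (pt i + upper l) \<subseteq> T"
    "box (pt i' + lower (Suc l)) (pt i' + upper (Suc l)) \<subseteq> T"
    "T \<subseteq> interior (cbox (pt i + lower l) (pt i + upper l) \<union> cbox (pt i' + lower (Suc l)) (pt i' + upper (Suc l)))"
  proof (rule connected_box_pair[of "pt i + lower l" "pt i + upper l" "pt i' + lower (Suc l)" "pt i' + upper (Suc l)" j0])
    show "(pt i + upper l) $ j0 = (pt i' + lower (Suc l)) $ j0"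
      using j0 by (simp add: pt_def lift_nth lower_def upper_def add.commute)
    fix j assume "j \<noteq> j0"
    then have "h j \<noteq> 0" using j0 inj_h by (metis injD)
    then show "(pt i + lower l) $ j < (pt i' + upper (Suc l)) $ j \<and> (pt i' + lower (Suc l)) $ j < (pt i + upper l) $ j"
      using off[of j] by (auto simp: lower_def upper_def)
  qed (auto simp: lower_less_upper)
  note T(4)
  also have "interior (cbox (pt i + lower l) (pt i + upper l) \<union> cbox (pt i' + lower (Suc l)) (pt i' + upper (Suc l))) \<subseteq> body"
    unfolding body_def
  proof (intro interior_mono Un_least)
    show "cbox (pt i + lower l) (pt i + upper l) \<subseteq> (\<Union>(i, l)\<in>index \<times> {..<6}. cbox (pt i + lower l) (pt i + upper l))"
      using assms(1,3) by (intro UN_upper[of "(i, l)", THEN subset_trans[rotated]]) auto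
    show "cbox (pt i' + lower (Suc l)) (pt i' + upper (Suc l)) \<subseteq> (\<Union>(i, l)\<in>index \<times> {..<6}. cbox (pt i + lower l) (pt i + upper l))"
      using assms(2,3) by (intro UN_upper[of "(i', Suc l)", THEN subset_trans[rotated]]) auto
  qed
  finally have "T \<subseteq> body" .
  then show ?thesis
    unfolding connected_component_def using T centre_in_box by blast
qed

lemma linked_trans: "linked i l i' l' \<Longrightarrow> linked i' l' i'' l'' \<Longrightarrow> linked i l i'' l''"
  by (rule connected_component_trans)

lemma linked_sym: "linked i l i' l' \<Longrightarrow> linked i' l' i l"
  by (rule connected_component_sym)

lemma linked_column:
  assumes "i \<in> index" "l < 6"
  shows "linked i l i 0"
  using assms(2)
proof (induction l)
  case 0
  have "centre i 0 \<in> body" using box_subset_body[OF assms(1), of 0] centre_in_box[of i 0] by auto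
  then show ?case by (rule connected_component_refl)
next
  case (Suc l)
  then have "linked i l i (Suc l)" using assms by (intro linked_if_stacked) auto
  with Suc show ?case using linked_trans linked_sym by (metis Suc_lessD)
qed

lemma linked_simplex:
  assumes "r < 6" "k \<in> grid M"
  shows "linked (r, k) 0 (0, k) 0"
proof -
  have ind: "(r, k) \<in> index" "(0, k) \<in> index" using assms by (auto simp: index_def)
  consider "r = 0" | "r = 5" | "1 \<le> r" "r \<le> 4" using assms by linarith
  then show ?thesis
  proof cases
    case 1
    then show ?thesis using linked_column[OF ind(2), of 0] by simp
  next
    case 2
    then have "linked (r, k) 0 (0, k) (Suc 0)"
      using ind by (intro linked_if_stacked) (auto simp: coord_def simplex_pt_def)
    moreover have "linked (0, k) (Suc 0) (0, k) 0" using ind by (intro linked_column) auto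
    ultimately show ?thesis by (rule linked_trans)
  next
    case 3
    then have "linked (0, k) 0 (r, k) (Suc 0)"
      using ind by (intro linked_if_stacked) (auto simp: coord_def simplex_pt_def)
    moreover have "linked (r, k) (Suc 0) (r, k) 0" using ind by (intro linked_column) auto
    ultimately show ?thesis by (rule linked_sym[OF linked_trans])
  qed
qed

text \<open>The step uses \<open>-(e\<^sub>1 + \<dots> + e\<^sub>4) + 3 e\<^sub>m - e\<^sub>m\<close>, whose entries are \<open>-1\<close> except for \<open>1\<close> in direction \<open>m\<close>.\<close>

lemma linked_step:
  assumes "k \<in> grid M" "k' \<in> grid M" "m \<in> {1..4}" "k' = k(m := Suc (k m))"
  shows "linked (0, k') 0 (0, k) 0"
proof -
  have ind: "(5, k') \<in> index" "(m, k) \<in> index" using assms by (auto simp: index_def)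
  have "linked (5, k') m (m, k) (Suc m)"
    using assms(3,4) ind by (intro linked_if_stacked) (auto simp: coord_def simplex_pt_def)
  moreover have "linked (5, k') 0 (5, k') m" "linked (m, k) (Suc m) (m, k) 0"
    using linked_sym[OF linked_column[OF ind(1), of m]] linked_column[OF ind(2), of "Suc m"] assms(3) by auto
  moreover have "linked (0, k') 0 (5, k') 0" "linked (m, k) 0 (0, k) 0"
    using linked_sym[OF linked_simplex[of 5 k']] linked_simplex[of m k] assms by auto
  ultimately show ?thesis by (meson linked_trans)
qed

lemma linked_grid:
  assumes "k \<in> grid M"
  shows "linked (0, k) 0 (0, \<lambda>m\<in>{1..4}. 0) 0"
  using assms
proof (induction "\<Sum>m=1..4. k m" arbitrary: k)
  case 0
  then have "k = (\<lambda>m\<in>{1..4}. 0)" by (intro PiE_ext[of k "{1..4}" _ _]) auto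
  moreover have "(0, k) \<in> index" using 0 by (simp add: index_def)
  ultimately show ?case using linked_column[of "(0, k)" 0] by (simp only: zero_less_numeral)
next
  case (Suc n)
  then obtain m where m: "m \<in> {1..4}" "k m \<noteq> 0" by (metis sum.neutral nat.distinct(1))
  define k0 where "k0 = k(m := k m - 1)"
  have "k0 i < M" if "i \<in> {1..4}" for i
    using PiE_mem[OF Suc(3) that] by (auto simp: k0_def)
  moreover have "k0 i = undefined" if "i \<notin> {1..4}" for i
    using PiE_arb[OF Suc(3) that] m that by (auto simp: k0_def)
  ultimately have k0: "k0 \<in> grid M" by (intro PiE_I) auto
  have "(\<Sum>m=1..4. k m) = k m + (\<Sum>i\<in>{1..4} - {m}. k i)" using m by (intro sum.remove) auto
  moreover have "(\<Sum>m=1..4. k0 m) = k0 m + (\<Sum>i\<in>{1..4} - {m}. k0 i)" using m by (intro sum.remove) auto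
  moreover have "(\<Sum>i\<in>{1..4} - {m}. k0 i) = (\<Sum>i\<in>{1..4} - {m}. k i)" by (intro sum.cong) (auto simp: k0_def)
  ultimately have "n = (\<Sum>m=1..4. k0 m)" using Suc(2) m by (simp add: k0_def)
  then have "linked (0, k0) 0 (0, \<lambda>m\<in>{1..4}. 0) 0" using Suc(1) k0 by blast
  moreover have "linked (0, k) 0 (0, k0) 0"
    using m by (intro linked_step[OF k0 Suc(3) m(1)]) (auto simp: k0_def)
  ultimately show ?case using linked_trans by blast
qed

text \<open>Every open box is linked to one base point, so a single component contains
  \<open>U\<close>; and \<open>body\<close> lies between this component and its closure.\<close>

lemma connected_body: "connected body"
proof -
  define o' where "o' = centre (0, \<lambda>m\<in>{1..4}. 0) 0"
  let ?C = "connected_component_set body o'"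
  have "U \<subseteq> ?C"
  proof
    fix x assume "x \<in> U"
    then obtain i l where il: "i \<in> index" "l < 6" "x \<in> box (pt i + lower l) (pt i + upper l)"
      unfolding U_def union_cells by auto
    obtain r k where i: "i = (r, k)" "r < 6" "k \<in> grid M" using il(1) by (auto simp: index_def)
    have "connected_component body x (centre i l)"
      unfolding connected_component_def using box_subset_body[OF il(1,2)] centre_in_box il(3)
      by (intro exI[of _ "box (pt i + lower l) (pt i + upper l)"]) (auto intro: convex_connected convex_box)
    moreover have "connected_component body (centre i l) o'"
      using linked_column[OF il(1,2)] linked_simplex[OF i(2,3)] linked_grid[OF i(3)] linked_trans
      unfolding o'_def i(1) by blast
    ultimately show "x \<in> ?C" by (metis connected_component_sym connected_component_trans mem_Collect_eq)
  qed
  moreover have "body \<subseteq> closure U"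
  proof -
    have "cbox (pt i + lower l) (pt i + upper l) \<subseteq> closure U" if "i \<in> index" "l < 6" for i l
    proof -
      have "cbox (pt i + lower l) (pt i + upper l) = closure (box (pt i + lower l) (pt i + upper l))"
        using centre_in_box by (intro closure_box[symmetric]) blast
      also have "\<dots> \<subseteq> closure U"
        unfolding U_def union_cells using that by (intro closure_mono) auto
      finally show ?thesis .
    qed
    then show ?thesis unfolding body_def using interior_subset by (blast intro: subset_trans)
  qed
  ultimately have "body \<subseteq> closure ?C" using closure_mono by blast
  then show ?thesis
    by (intro connected_intermediate_closure[OF connected_connected_component connected_component_subset])
qed

section \<open>Reduction of a tiling by the body to a tiling of the integer lattice\<close>

lemma body_not_tile:
  assumes M: "M > 4 * 9 ^ 4 + 2"
  shows "\<not> tiles_by_translations body"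
proof
  assume "tiles_by_translations body"
  then obtain A where A: "countable A" "AE x in lebesgue. \<exists>!a. a \<in> A \<and> x \<in> (\<lambda>y. y + a) ` body"
    by (auto simp: tiles_by_translations_def)
  obtain N where N: "negligible N" "\<And>x. x \<notin> N \<Longrightarrow> \<exists>!a. a \<in> A \<and> x \<in> (\<lambda>y. y + a) ` body"
    using A(2) by (auto elim!: AE_E3 simp: negligible_iff_null_sets)
  \<comment> \<open>For \<open>x\<close> outside this null set, all points of the coset of
    \<open>x\<close> are covered exactly once, and none of them lies on the glued part
    \<open>body - U\<close> of a translate. The whole coset is then tiled by translates of
    \<open>U\<close>.\<close>
  define B where "B = (\<Union>z\<in>int_lattice. (+) (- z) ` N \<union> (\<Union>a\<in>A. (+) (a - z) ` (body - U)))"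
  have "negligible ((+) (- z) ` N \<union> (\<Union>a\<in>A. (+) (a - z) ` (body - U)))" for z
    using A(1) N(1) body_negligible unfolding U_def
    by (intro negligible_Un negligible_translation negligible_countable_Union) (auto intro: negligible_translation)
  then have "negligible B"
    unfolding B_def by (intro negligible_countable_Union countable_image countable_int_lattice) auto
  then obtain x where x: "x \<notin> B" by (metis UNIV_eq_I non_negligible_UNIV)
  have tile: "\<exists>!a. a \<in> A \<and> x + z - a \<in> U" if "z \<in> int_lattice" for z
  proof -
    have xz: "x + z \<notin> N"
    proof
      assume "x + z \<in> N"
      then have "x \<in> (+) (- z) ` N" by (intro image_eqI[of _ _ "x + z"]) auto
      then show False using x that unfolding B_def by blast
    qed
    have eq: "x + z \<in> (\<lambda>y. y + a) ` body \<longleftrightarrow> x + z - a \<in> U" if "a \<in> A" for a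
    proof
      assume "x + z \<in> (\<lambda>y. y + a) ` body"
      then have "x + z - a \<in> body" by auto
      moreover have "x + z - a \<notin> body - U"
      proof
        assume "x + z - a \<in> body - U"
        then have "x \<in> (+) (a - z) ` (body - U)" by (intro image_eqI[of _ _ "x + z - a"]) auto
        then show False using x that \<open>z \<in> int_lattice\<close> unfolding B_def by blast
      qed
      ultimately show "x + z - a \<in> U" by blast
    next
      assume "x + z - a \<in> U"
      then have "x + z - a \<in> body" using \<Omega>(2) unfolding U_def by blast
      then show "x + z \<in> (\<lambda>y. y + a) ` body" by (intro image_eqI[of _ _ "x + z - a"]) auto
    qed
    show ?thesis using N(2)[OF xz] eq by (metis (no_types, lifting))
  qed
  define vec where "vec w = lift (\<lambda>m. of_int (w m))" for w :: "nat \<Rightarrow> int"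
  have vec_int: "vec w \<in> int_lattice" for w by (simp add: vec_def int_lattice_def lift_nth)
  have vec_cong: "vec w = vec w' \<longleftrightarrow> (\<forall>m\<in>{1..4}. w m = w' m)" for w w'
  proof
    assume eq: "vec w = vec w'"
    show "\<forall>m\<in>{1..4}. w m = w' m"
    proof
      fix m :: nat assume m: "m \<in> {1..4}"
      then obtain j where "h j = m" using obtain_index by fastforce
      then show "w m = w' m" using eq m by (auto simp: vec_def vec_eq_iff lift_nth dest!: spec[of _ j])
    qed
  qed (auto simp: vec_def vec_eq_iff lift_nth)
  have vec_add: "vec w + pt i = vec (\<lambda>m. w m + coord i m)" for w i
    by (auto simp: vec_def pt_def vec_eq_iff lift_nth)
  \<comment> \<open>Where \<open>x + vec w\<close> lies in a translate of \<open>cell\<close>, the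
    same translation covers \<open>x + vec w + p\<close> for all points \<open>p\<close> of the
    finite set, so a copy of that set is placed at \<open>w\<close>. The functions are extensional,
    so equality of \<open>vec w\<close> and \<open>vec w'\<close> gives
    \<open>w = w'\<close>.\<close>
  define W where "W = {w \<in> {1..4} \<rightarrow>\<^sub>E UNIV. \<exists>a\<in>A. x + vec w - a \<in> cell}"
  show False
  proof (rule no_integer_tiling[OF M])
    fix z :: "nat \<Rightarrow> int"
    obtain a where a: "a \<in> A" "x + vec z - a \<in> U" using tile[OF vec_int] by blast
    then obtain i y where i: "i \<in> index" "y \<in> cell" "x + vec z - a = pt i + y" by (auto simp: U_def)
    obtain r k where rk: "i = (r, k)" "r < 6" "k \<in> grid M" using i(1) by (auto simp: index_def)
    define w where "w = (\<lambda>m\<in>{1..4}. z m - coord i m)"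
    have "vec w + pt i = vec z" unfolding vec_add vec_cong by (simp add: w_def)
    then have wz: "vec w = vec z - pt i" by (simp add: eq_diff_eq)
    have "x + vec w - a = y" unfolding wz using i(3) by (simp add: algebra_simps)
    then have "w \<in> W" unfolding W_def using i(2) a(1) by (auto simp: w_def)
    moreover have "\<forall>m\<in>{1..4}. z m = w m + simplex_pt r m + 3 * int (k m)"
      by (simp add: w_def coord_def rk)
    ultimately show "\<exists>w\<in>W. \<exists>r<6. \<exists>k\<in>grid M. \<forall>m\<in>{1..4}. z m = w m + simplex_pt r m + 3 * int (k m)"
      using rk by blast
  next
    fix w r k w' r' k'
    assume w: "w \<in> W" "w' \<in> W" and r: "r < 6" "r' < 6" and k: "k \<in> grid M" "k' \<in> grid M"
      and eq: "\<forall>m\<in>{1..4}. w m + simplex_pt r m + 3 * int (k m) = w' m + simplex_pt r' m + 3 * int (k' m)"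
    have ind: "(r, k) \<in> index" "(r', k') \<in> index" using r k by (auto simp: index_def)
    have veq: "vec w + pt (r, k) = vec w' + pt (r', k')"
      unfolding vec_add vec_cong using eq by (simp add: coord_def add.assoc)
    obtain a a' where a: "a \<in> A" "x + vec w - a \<in> cell" and a': "a' \<in> A" "x + vec w' - a' \<in> cell"
      using w unfolding W_def by blast
    define z where "z = vec w + pt (r, k)"
    have "x + z - a = pt (r, k) + (x + vec w - a)" "x + z - a' = pt (r', k') + (x + vec w' - a')"
      by (simp_all add: z_def) (simp add: veq)
    moreover have "pt i + y \<in> U" if "i \<in> index" "y \<in> cell" for i y
      using that unfolding U_def by blast
    ultimately have "x + z - a \<in> U" "x + z - a' \<in> U" using a(2) a'(2) ind by metis+
    moreover have "z \<in> int_lattice" by (simp add: z_def vec_int pt_int_lattice)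
    ultimately have "a = a'" using tile a(1) a'(1) by blast
    have "(x + vec w - a) - (x + vec w' - a') = vec w - vec w'" using \<open>a = a'\<close> by simp
    then have "x + vec w - a = x + vec w' - a'"
      using cell_inj[OF a(2) a'(2)] vec_int by auto
    then have vw: "vec w = vec w'" using \<open>a = a'\<close> by simp
    then have "pt (r, k) = pt (r', k')" using veq by simp
    then have "(r, k) = (r', k')" using inj_pt ind by (auto dest: inj_onD)
    moreover have "w = w'" using vw w unfolding vec_cong W_def by (intro PiE_ext[of w "{1..4}" _ w']) auto
    ultimately show "w = w' \<and> r = r' \<and> k = k'" by simp
  qed
qed

end

theorem theorem1p4:
  assumes "CARD('n::finite) \<ge> 5"
  shows "\<exists>\<Omega> :: (real ^ 'n) set. open \<Omega> \<and> emeasure lebesgue \<Omega> < \<infinity> \<and>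
    connected \<Omega> \<and> spectral \<Omega> \<and> \<not> tiles_by_translations \<Omega>"
proof -
  obtain h :: "'n \<Rightarrow> nat" where h: "bij_betw h UNIV {0..<CARD('n)}"
    using ex_bij_betw_finite_nat[of "UNIV :: 'n set"] by auto
  interpret stacked_boxes h "4 * 9 ^ 4 + 3"
  proof
    show "inj h" using h by (simp add: bij_betw_def)
    show "{..4} \<subseteq> range h" using h assms by (auto simp: bij_betw_def)
  qed simp
  have "emeasure lebesgue body < \<infinity>" using fmeasurableD2[OF lmeasurable_body] by (simp add: less_top)
  then show ?thesis
    using open_body connected_body spectral_union body_not_tile by auto
qed

end
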